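(* Let $\mathcal G$ be a compact finite metric tree with Dirichlet conditions imposed at all leaves and natural conditions at all other vertices. Then the first eigenvalue of the Laplacian on $\mathcal G$ satisfies $$\lambda_1(\mathcal G)\ \ge\ \frac{\pi^2}{(\operatorname{diam}\mathcal G)^2},$$ where $\operatorname{diam}\mathcal G$ is the diameter of $\mathcal G$, i.e. the maximal distance between a pair of leaves. If instead $\mathcal G$ has one leaf with the Neumann condition and all other leaves have the Dirichlet condition (natural conditions at all other vertices), then $$\lambda_1(\mathcal G)\ \ge\ \frac{\pi^2}{4(\operatorname{diam}\mathcal G)^2}.$$
   Context: A metric tree is a connected metric graph without cycles, consisting of finitely many edges of finite length (each identified with an interval $[0,\ell_e]$). Leaves are the vertices of degree one. The Laplacian acts as $-u''$ on each edge; natural conditions at a vertex mean continuity of $u$ at the vertex and vanishing of the sum of the derivatives of $u$ (directed into the edges) over all incident edges; the Dirichlet condition at a leaf is $u=0$ and the Neumann condition is $u'=0$ there. $\lambda_1(\mathcal G)$ is the smallest eigenvalue, i.e. the minimum of $\int_{\mathcal G}|u'|^2dx/\int_{\mathcal G}|u|^2dx$ over nonzero continuous functions $u$ on $\mathcal G$ that are $H^1$ on each edge and vanish at the Dirichlet leaves. *)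

theory Defs
  imports Complex_Main "Graph_Theory.Graph_Theory"
begin

text \<open>
  A metric graph is given by a finite directed multigraph together with a length for every arc.
  The direction of an arc \<open>e\<close> carries no meaning of its own; it only fixes the identification of
  the edge with the interval \<open>{0..len e}\<close>, in which \<open>0\<close> corresponds to \<open>tail G e\<close> and
  \<open>len e\<close> to \<open>head G e\<close>.

  Every edge has two ends. The end at \<open>tail G e\<close> is \<open>(e, True)\<close> and the end at \<open>head G e\<close> is
  \<open>(e, False)\<close>. The graph of ends has every edge once in each direction, an end being an arc
  that leaves its vertex; walks in it are the undirected walks of \<open>G\<close>, and its out-degrees are
  the degrees of \<open>G\<close> (loops counted twice).
\<close>

definition ends_graph :: "('v, 'e) pre_digraph \<Rightarrow> ('v, 'e \<times> bool) pre_digraph" where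
  "ends_graph G = \<lparr> verts = verts G, arcs = arcs G \<times> UNIV,
     tail = (\<lambda>(e, b). if b then tail G e else head G e),
     head = (\<lambda>(e, b). if b then head G e else tail G e) \<rparr>"

definition ends_at :: "('v, 'e) pre_digraph \<Rightarrow> 'v \<Rightarrow> ('e \<times> bool) set" where
  "ends_at G v = out_arcs (ends_graph G) v"

definition leaves :: "('v, 'e) pre_digraph \<Rightarrow> 'v set" where
  "leaves G = {v \<in> verts G. out_degree (ends_graph G) v = 1}"

text \<open>
  The library's \<open>forest\<close> only excludes directed cycles and is therefore not usable here. An
  undirected cycle is a cycle of the graph of ends that uses no edge twice, which excludes
  going back and forth along one edge, but includes loops and pairs of parallel edges.
\<close>

definition acyclic_graph :: "('v, 'e) pre_digraph \<Rightarrow> bool" where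
  "acyclic_graph G \<longleftrightarrow> \<not> (\<exists>p. pre_digraph.cycle (ends_graph G) p \<and> distinct (map fst p))"

definition metric_tree :: "('v, 'e) pre_digraph \<Rightarrow> ('e \<Rightarrow> real) \<Rightarrow> bool" where
  "metric_tree G len \<longleftrightarrow> fin_digraph G \<and> arcs G \<noteq> {} \<and> (\<forall>e \<in> arcs G. 0 < len e)
     \<and> connected G \<and> acyclic_graph G"

definition vertex_dist :: "('v, 'e) pre_digraph \<Rightarrow> ('e \<Rightarrow> real) \<Rightarrow> 'v \<Rightarrow> 'v \<Rightarrow> real" where
  "vertex_dist G len v w = real_of_ereal (wf_digraph.\<mu> (ends_graph G) (len \<circ> fst) v w)"

definition tree_diam :: "('v, 'e) pre_digraph \<Rightarrow> ('e \<Rightarrow> real) \<Rightarrow> real" where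
  "tree_diam G len = Max ((\<lambda>(v, w). vertex_dist G len v w) ` (leaves G \<times> leaves G))"

datatype vertex_condition = Natural | Dirichlet | Neumann

text \<open>
  A function on the graph is a family \<open>u\<close> of functions on the edges. For an end \<open>a\<close> of an edge,
  \<open>end_value\<close> is the limit value of \<open>u\<close> there, and \<open>end_deriv\<close> is the derivative directed
  into the edge, where \<open>u'\<close> is the derivative of \<open>u\<close> with respect to the edge coordinate.
\<close>

definition end_value :: "('e \<Rightarrow> real) \<Rightarrow> ('e \<Rightarrow> real \<Rightarrow> real) \<Rightarrow> 'e \<times> bool \<Rightarrow> real" where
  "end_value len u = (\<lambda>(e, b). if b then u e 0 else u e (len e))"

definition end_deriv :: "('e \<Rightarrow> real) \<Rightarrow> ('e \<Rightarrow> real \<Rightarrow> real) \<Rightarrow> 'e \<times> bool \<Rightarrow> real" where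
  "end_deriv len u' = (\<lambda>(e, b). if b then u' e 0 else - u' e (len e))"

fun satisfies_condition :: "('v, 'e) pre_digraph \<Rightarrow> ('e \<Rightarrow> real) \<Rightarrow> ('e \<Rightarrow> real \<Rightarrow> real)
    \<Rightarrow> ('e \<Rightarrow> real \<Rightarrow> real) \<Rightarrow> 'v \<Rightarrow> vertex_condition \<Rightarrow> bool" where
  "satisfies_condition G len u u' v Natural \<longleftrightarrow>
     (\<forall>a \<in> ends_at G v. \<forall>b \<in> ends_at G v. end_value len u a = end_value len u b)
     \<and> (\<Sum>a \<in> ends_at G v. end_deriv len u' a) = 0"
| "satisfies_condition G len u u' v Dirichlet \<longleftrightarrow> (\<forall>a \<in> ends_at G v. end_value len u a = 0)"
| "satisfies_condition G len u u' v Neumann \<longleftrightarrow> (\<forall>a \<in> ends_at G v. end_deriv len u' a = 0)"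

text \<open>
  Eigenvalues of the Laplacian \<open>u \<mapsto> - u''\<close> with vertex conditions \<open>bc\<close>. The operator is
  self-adjoint with real coefficients, and solutions of \<open>- u'' = lam * u\<close> on an edge are smooth
  up to the ends, so real classical eigenfunctions suffice. Derivatives at the ends of
  \<open>{0..len e}\<close> are one-sided.
\<close>

definition laplace_eigenvalue ::
    "('v, 'e) pre_digraph \<Rightarrow> ('e \<Rightarrow> real) \<Rightarrow> ('v \<Rightarrow> vertex_condition) \<Rightarrow> real \<Rightarrow> bool" where
  "laplace_eigenvalue G len bc lam \<longleftrightarrow> (\<exists>u u' u''.
     (\<forall>e \<in> arcs G. \<forall>x \<in> {0..len e}.
        (u e has_real_derivative u' e x) (at x within {0..len e})
        \<and> (u' e has_real_derivative u'' e x) (at x within {0..len e})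
        \<and> - u'' e x = lam * u e x)
     \<and> (\<forall>v \<in> verts G. satisfies_condition G len u u' v (bc v))
     \<and> (\<exists>e \<in> arcs G. \<exists>x \<in> {0..len e}. u e x \<noteq> 0))"

definition first_eigenvalue ::
    "('v, 'e) pre_digraph \<Rightarrow> ('e \<Rightarrow> real) \<Rightarrow> ('v \<Rightarrow> vertex_condition) \<Rightarrow> real" where
  "first_eigenvalue G len bc = (LEAST lam. laplace_eigenvalue G len bc lam)"

definition dirichlet_conditions :: "('v, 'e) pre_digraph \<Rightarrow> 'v \<Rightarrow> vertex_condition" where
  "dirichlet_conditions G v = (if v \<in> leaves G then Dirichlet else Natural)"

end

theory Submission
  imports Defs "HOL-Analysis.Analysis"
begin

text \<open>
  The bound comes from a positive supersolution. Let \<open>c\<close> be the midpoint of a diametral path.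
  Every point of the tree is within half the diameter of \<open>c\<close>, so for \<open>k\<close> below \<open>pi\<close> over the
  diameter the cosine of \<open>k\<close> times the distance to \<open>c\<close> is positive. It solves \<open>- w'' = k\<^sup>2 * w\<close>
  on every edge. At an inner vertex at most one edge leads towards \<open>c\<close> and at least one leads away, so
  the sum of its derivatives into the edges is at most zero. A positive supersolution forces every
  eigenvalue to be at least \<open>k\<^sup>2\<close>. With one Neumann leaf, that leaf takes the part of \<open>c\<close> and the
  whole diameter the part of half the diameter. Both cases are instances of \<open>first_eigenvalue_ge\<close>,
  where the centre is the midpoint of the path between two given, possibly equal, vertices.

  The first eigenvalue is defined as a least element of the set of eigenvalues, and nothing can be said about it
  before that set is known to have a minimum. Both this and the comparison with the supersolution
  are reduced to a quadratic form on vertex values. As long as \<open>k * l < pi\<close> on every edge, the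
  \<open>k\<close>-energy of a function, the integral of \<open>u'\<^sup>2 - k\<^sup>2 * u\<^sup>2\<close>, has a unique minimiser with given
  vertex values, and its minimum is an explicit quadratic form \<open>energy k\<close> in them.
  \<^item> If the form is nonnegative on functions that vanish at the Dirichlet vertices, then no
    eigenvalue lies below \<open>k\<^sup>2\<close> (\<open>no_eigenvalue_below\<close>), because the flux of an eigenfunction
    dominates its energy edge by edge (\<open>edge_energy_le_flux\<close>).
  \<^item> If the form is moreover degenerate, its null vectors satisfy the vertex conditions and
    \<open>k\<^sup>2\<close> is an eigenvalue (\<open>eigenvalue_if_null_vector\<close>).
  \<^item> A positive supersolution makes the form nonnegative
    (\<open>energy_nonneg_if_supersolution\<close>, a discrete Picone identity).

  Let \<open>k\<close> increase from a value where the form is nonnegative. Either the form becomes negative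
  somewhere before \<open>k\<close> times the greatest edge length reaches \<open>pi\<close>; then by compactness there is a first
  \<open>k\<close> at which it degenerates, and \<open>k\<^sup>2\<close> is the least eigenvalue. Or it stays nonnegative; then the
  longest edge has Dirichlet conditions at both ends, and the sine on that edge is a first
  eigenfunction.

  The tree enters through unique reduced walks, that is walks that never turn back along the edge
  just used. They give the distances, the fact that at most one edge at a vertex leads towards a
  given vertex, and the shape of the distance to the midpoint.
\<close>


section \<open>Energy of a single edge\<close>

text \<open>
  The minimum of the integral of \<open>y'\<^sup>2 - k\<^sup>2 * y\<^sup>2\<close> over \<open>{0..l}\<close> for functions with end values \<open>a\<close>
  and \<open>b\<close>, provided that \<open>k * l < pi\<close>. It is attained at the solution of \<open>- y'' = k\<^sup>2 * y\<close>.
\<close>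
definition edge_energy :: "real \<Rightarrow> real \<Rightarrow> real \<Rightarrow> real \<Rightarrow> real" where
  "edge_energy k l a b = k * ((a\<^sup>2 + b\<^sup>2) * cos (k * l) - 2 * a * b) / sin (k * l)"

text \<open>
  The right-hand side is the integral of \<open>u'\<^sup>2 - lam * u\<^sup>2\<close>, so the claim is the minimality of the
  \<open>k\<close>-solution \<open>y\<close> with the end values of \<open>u\<close>, and the strictness comes from the surplus
  \<open>(k\<^sup>2 - lam) * u\<^sup>2\<close>. The proof is Jacobi's: as \<open>k * l < pi\<close>, there is a solution \<open>\<phi>\<close> of
  \<open>- \<phi>'' = k\<^sup>2 * \<phi>\<close> without zeros, and the energy of \<open>v = u - y\<close> becomes the integral of a square
  after the boundary term \<open>v\<^sup>2 * \<phi>' / \<phi>\<close>, which vanishes at both ends, has been split off. Integrals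
  are avoided by showing that the primitive \<open>g\<close> of the nonnegative integrand is monotone.
\<close>
lemma edge_energy_le_flux:
  fixes u u' u'' :: "real \<Rightarrow> real"
  assumes k: "0 < k" and l: "0 < l" and kl: "k * l < pi" and lam: "lam < k\<^sup>2"
    and du: "\<And>x. x \<in> {0..l} \<Longrightarrow> (u has_real_derivative u' x) (at x within {0..l})"
    and du': "\<And>x. x \<in> {0..l} \<Longrightarrow> (u' has_real_derivative u'' x) (at x within {0..l})"
    and eq: "\<And>x. x \<in> {0..l} \<Longrightarrow> - u'' x = lam * u x"
  shows "edge_energy k l (u 0) (u l) \<le> u l * u' l - u 0 * u' 0"
    and "\<exists>x \<in> {0..l}. u x \<noteq> 0 \<Longrightarrow> edge_energy k l (u 0) (u l) < u l * u' l - u 0 * u' 0"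
proof -
  have s0: "sin (k * l) > 0" using k l kl by (intro sin_gt_zero) auto
  define A where "A = (u l - u 0 * cos (k * l)) / sin (k * l)"
  define y where "y x = u 0 * cos (k * x) + A * sin (k * x)" for x
  define y' where "y' x = - (k * u 0 * sin (k * x)) + k * A * cos (k * x)" for x
  \<comment> \<open>Half of the gap to \<open>pi\<close>, so that \<open>\<phi>\<close> has no zero on the closed edge.\<close>
  define eps where "eps = (pi - k * l) / 2"
  define \<phi> where "\<phi> x = sin (k * x + eps)" for x
  define \<phi>' where "\<phi>' x = k * cos (k * x + eps)" for x
  define v where "v x = u x - y x" for x
  define v' where "v' x = u' x - y' x" for x
  define g where "g x = u x * u' x - y x * y' x - 2 * (y' x * v x) - (v x)\<^sup>2 * (\<phi>' x / \<phi> x)" for x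
  define g' where "g' x = (k\<^sup>2 - lam) * (u x)\<^sup>2 + (v' x - v x * (\<phi>' x / \<phi> x))\<^sup>2" for x
  have \<phi>pos: "\<phi> x > 0" if "x \<in> {0..l}" for x
  proof -
    have "0 \<le> k * x" "k * x \<le> k * l" using that k by (auto intro: mult_left_mono)
    then have "0 < k * x + eps \<and> k * x + eps < pi" using kl unfolding eps_def by (auto simp: field_simps)
    then show ?thesis by (simp add: \<phi>_def sin_gt_zero)
  qed
  have dy: "(y has_real_derivative y' x) (at x within {0..l})" for x
    unfolding y_def y'_def by (auto intro!: derivative_eq_intros simp: algebra_simps)
  have dy': "(y' has_real_derivative - (k\<^sup>2 * y x)) (at x within {0..l})" for x
    unfolding y_def y'_def
    by (auto intro!: derivative_eq_intros simp: algebra_simps power2_eq_square)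
  have d\<phi>: "(\<phi> has_real_derivative \<phi>' x) (at x within {0..l})" for x
    unfolding \<phi>_def \<phi>'_def by (auto intro!: derivative_eq_intros simp: algebra_simps)
  have d\<phi>': "(\<phi>' has_real_derivative - (k\<^sup>2 * \<phi> x)) (at x within {0..l})" for x
    unfolding \<phi>_def \<phi>'_def
    by (auto intro!: derivative_eq_intros simp: algebra_simps power2_eq_square)
  have dg: "(g has_real_derivative g' x) (at x within {0..l})" if x: "x \<in> {0..l}" for x
  proof -
    have dv: "(v has_real_derivative v' x) (at x within {0..l})"
      unfolding v_def v'_def by (intro DERIV_diff du[OF x] dy)
    have p: "\<phi> x \<noteq> 0" using \<phi>pos[OF x] by simp
    have "(g has_real_derivative
        (u' x * u' x + u'' x * u x) - (y' x * y' x + - (k\<^sup>2 * y x) * y x)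
         - 2 * (- (k\<^sup>2 * y x) * v x + v' x * y' x)
         - (2 * v x * v' x * (\<phi>' x / \<phi> x) + (- (k\<^sup>2 * \<phi> x) * \<phi> x - \<phi>' x * \<phi>' x) / (\<phi> x * \<phi> x) * (v x)\<^sup>2))
        (at x within {0..l})"
      unfolding g_def
      by (rule derivative_eq_intros du[OF x] du'[OF x] dy dy' dv d\<phi> d\<phi>' p refl)+
         (simp add: algebra_simps)
    moreover have "(u' x * u' x + u'' x * u x) - (y' x * y' x + - (k\<^sup>2 * y x) * y x)
         - 2 * (- (k\<^sup>2 * y x) * v x + v' x * y' x)
         - (2 * v x * v' x * (\<phi>' x / \<phi> x) + (- (k\<^sup>2 * \<phi> x) * \<phi> x - \<phi>' x * \<phi>' x) / (\<phi> x * \<phi> x) * (v x)\<^sup>2)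
         = g' x"
    proof -
      define r where "r = \<phi>' x / \<phi> x"
      have r: "(- (k\<^sup>2 * \<phi> x) * \<phi> x - \<phi>' x * \<phi>' x) / (\<phi> x * \<phi> x) = - k\<^sup>2 - r\<^sup>2"
        using p by (simp add: r_def field_simps power2_eq_square)
      have u: "u'' x = - (lam * u x)" using eq[OF x] by simp
      have uy: "u x = y x + v x" "u' x = y' x + v' x" by (simp_all add: v_def v'_def)
      show ?thesis
        unfolding g'_def r u r_def[symmetric] uy by (simp add: algebra_simps power2_eq_square)
    qed
    ultimately show ?thesis by simp
  qed
  have g'_nonneg: "0 \<le> g' x" for x using lam by (simp add: g'_def)
  \<comment> \<open>\<open>g\<close> increases, and its total increase is the difference of the two sides.\<close>
  have mono: "g x \<le> g z" if "0 \<le> x" "x \<le> z" "z \<le> l" for x z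
  proof (rule DERIV_nonneg_imp_increasing_open[of x z g])
    fix t assume t: "x < t" "t < z"
    then have "at t within {0..l} = at t" using that by (intro at_within_Icc_at) auto
    then show "\<exists>d. (g has_real_derivative d) (at t) \<and> 0 \<le> d"
      using dg[of t] g'_nonneg[of t] t that by auto
  next
    have "continuous_on {0..l} g" by (rule DERIV_continuous_on[OF dg])
    then show "continuous_on {x..z} g" using that by (auto intro: continuous_on_subset)
  qed (use that in auto)
  have v0: "v 0 = 0" "v l = 0" using s0 by (simp_all add: v_def y_def A_def)
  have boundary: "g l - g 0 = (u l * u' l - u 0 * u' 0) - edge_energy k l (u 0) (u l)"
  proof -
    have yl: "y l = u l" "y 0 = u 0" using v0 by (simp_all add: v_def)
    have y'0: "y' 0 = k * (u l - u 0 * cos (k * l)) / sin (k * l)" by (simp add: y'_def A_def)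
    have y'l: "y' l = k * (u l * cos (k * l) - u 0) / sin (k * l)"
    proof -
      have "A * sin (k * l) = u l - u 0 * cos (k * l)" using s0 by (simp add: A_def)
      moreover have "y' l * sin (k * l) = k * (A * sin (k * l)) * cos (k * l) - k * u 0 * (sin (k * l))\<^sup>2"
        by (simp add: y'_def algebra_simps power2_eq_square)
      ultimately have "y' l * sin (k * l)
          = k * (u l - u 0 * cos (k * l)) * cos (k * l) - k * u 0 * (1 - (cos (k * l))\<^sup>2)"
        by (simp only: sin_squared_eq)
      then have "y' l * sin (k * l) = k * (u l * cos (k * l) - u 0)"
        by (simp add: algebra_simps power2_eq_square)
      then show ?thesis using s0 by (simp add: field_simps)
    qed
    have "y l * y' l - y 0 * y' 0 = edge_energy k l (u 0) (u l)"
      unfolding yl edge_energy_def y'0 y'l divide_inverse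
      by (simp add: algebra_simps power2_eq_square)
    then show ?thesis using v0 by (simp add: g_def algebra_simps)
  qed
  show le: "edge_energy k l (u 0) (u l) \<le> u l * u' l - u 0 * u' 0"
    using mono[of 0 l] l boundary by simp
  assume "\<exists>x \<in> {0..l}. u x \<noteq> 0"
  then obtain z where z: "z \<in> {0..l}" "u z \<noteq> 0" by blast
  show "edge_energy k l (u 0) (u l) < u l * u' l - u 0 * u' 0"
  proof (rule ccontr)
    assume "\<not> ?thesis"
    \<comment> \<open>Equality makes \<open>g\<close> constant, hence its derivative, which bounds \<open>(k\<^sup>2 - lam) * u\<^sup>2\<close>, is zero.\<close>
    then have "g l = g 0" using le boundary by simp
    then have const: "g x = g 0" if "x \<in> {0..l}" for x
      using mono[of 0 x] mono[of x l] that by auto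
    have "(g has_real_derivative g' z) (at z within {0..l})" using dg z by blast
    moreover have "(g has_real_derivative 0) (at z within {0..l})"
      by (rule has_field_derivative_transform_within[of "\<lambda>_. g 0" _ _ _ 1])
         (use const[symmetric] z(1) in simp_all)
    ultimately have "g' z = 0"
      using vector_derivative_unique_within_closed_interval[of 0 l z g "g' z" 0] l z(1)
      by (simp add: has_real_derivative_iff_has_vector_derivative)
    then show False
      using lam z(2) unfolding g'_def by (auto simp: add_nonneg_eq_0_iff)
  qed
qed

section \<open>Discrete energy of a metric graph\<close>

definition opposite_end :: "'e \<times> bool \<Rightarrow> 'e \<times> bool" where
  "opposite_end a = (fst a, \<not> snd a)"

lemma opposite_end_simps [simp]:
  "opposite_end (opposite_end a) = a" "fst (opposite_end a) = fst a"
  "opposite_end a \<noteq> a" "a \<noteq> opposite_end a"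
  "opposite_end a = opposite_end b \<longleftrightarrow> a = b"
  by (auto simp: opposite_end_def prod_eq_iff)

locale finite_metric_graph =
  fixes G :: "('v, 'e) pre_digraph" and len :: "'e \<Rightarrow> real"
  assumes fin_digraph: "fin_digraph G" and arcs_nonempty: "arcs G \<noteq> {}"
    and len_pos: "e \<in> arcs G \<Longrightarrow> 0 < len e"
begin

sublocale base: fin_digraph G by (rule fin_digraph)

abbreviation ends :: "('v, 'e \<times> bool) pre_digraph" where
  "ends \<equiv> ends_graph G"

lemma ends_verts [simp]: "verts ends = verts G"
  and in_arcs_ends: "a \<in> arcs ends \<longleftrightarrow> fst a \<in> arcs G"
  and ends_tail_opposite [simp]: "tail ends (opposite_end a) = head ends a"
  and ends_head_opposite [simp]: "head ends (opposite_end a) = tail ends a"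
  by (auto simp: ends_graph_def opposite_end_def mem_Times_iff split: prod.splits)

lemma opposite_end_in_arcs [simp]: "opposite_end a \<in> arcs ends \<longleftrightarrow> a \<in> arcs ends"
  by (simp add: in_arcs_ends)

sublocale ends: wf_digraph ends
  by standard (auto simp: ends_graph_def)

lemma finite_ends_at: "finite (ends_at G v)"
  by (rule finite_subset[of _ "arcs G \<times> UNIV"])
     (auto simp: ends_at_def out_arcs_def in_arcs_ends mem_Times_iff)

lemma in_ends_at: "a \<in> ends_at G v \<longleftrightarrow> a \<in> arcs ends \<and> tail ends a = v"
  by (simp add: ends_at_def)

lemma leaves_iff: "v \<in> leaves G \<longleftrightarrow> v \<in> verts G \<and> card (ends_at G v) = 1"
  by (simp add: leaves_def out_degree_def ends_at_def)

lemma sum_over_ends: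
  fixes f :: "'e \<times> bool \<Rightarrow> real"
  shows "(\<Sum>v\<in>verts G. \<Sum>a\<in>ends_at G v. f a) = (\<Sum>e\<in>arcs G. f (e, True) + f (e, False))"
proof -
  have fin: "finite (arcs G \<times> (UNIV :: bool set))" by simp
  have img: "tail ends ` (arcs G \<times> UNIV) \<subseteq> verts G"
    using ends.tail_in_verts by (auto simp: in_arcs_ends)
  have at: "ends_at G v = {a \<in> arcs G \<times> UNIV. tail ends a = v}" for v
    by (auto simp: in_ends_at in_arcs_ends)
  have "(\<Sum>v\<in>verts G. \<Sum>a\<in>ends_at G v. f a) = (\<Sum>a\<in>arcs G \<times> UNIV. f a)"
    unfolding at by (rule sum.group[OF fin _ img]) simp
  also have "\<dots> = (\<Sum>e\<in>arcs G. \<Sum>b\<in>UNIV. f (e, b))"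
    by (simp add: sum.cartesian_product)
  finally show ?thesis by (simp add: UNIV_bool add.commute)
qed

definition energy :: "real \<Rightarrow> ('v \<Rightarrow> real) \<Rightarrow> real" where
  "energy k a = (\<Sum>e\<in>arcs G. edge_energy k (len e) (a (tail G e)) (a (head G e)))"

text \<open>
  The derivative, directed into the edge, of the solution of \<open>- y'' = k\<^sup>2 * y\<close> that has the values of
  \<open>a\<close> at the two ends of the edge.
\<close>
definition flux :: "real \<Rightarrow> ('v \<Rightarrow> real) \<Rightarrow> 'e \<times> bool \<Rightarrow> real" where
  "flux k a c = k * (a (head ends c) - a (tail ends c) * cos (k * len (fst c))) / sin (k * len (fst c))"

lemma ends_simps [simp]:
  "tail ends (e, True) = tail G e" "tail ends (e, False) = head G e"
  "head ends (e, True) = head G e" "head ends (e, False) = tail G e"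
  by (simp_all add: ends_graph_def)

text \<open>
  The polar form of the energy is minus the pairing of vertex values with the sums of fluxes, by
  partial summation. Hence a minimiser of the energy satisfies the Kirchhoff conditions.
\<close>
lemma energy_add_scaled:
  "energy k (\<lambda>v. a v + t * b v) = energy k a
     - 2 * t * (\<Sum>v\<in>verts G. b v * (\<Sum>c\<in>ends_at G v. flux k a c)) + t\<^sup>2 * energy k b"
proof -
  have "(\<Sum>v\<in>verts G. b v * (\<Sum>c\<in>ends_at G v. flux k a c))
      = (\<Sum>v\<in>verts G. \<Sum>c\<in>ends_at G v. b (tail ends c) * flux k a c)"
    by (auto simp: sum_distrib_left in_ends_at intro!: sum.cong)
  also have "\<dots> = (\<Sum>e\<in>arcs G. b (tail G e) * flux k a (e, True) + b (head G e) * flux k a (e, False))"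
    by (simp add: sum_over_ends)
  finally have pair: "(\<Sum>v\<in>verts G. b v * (\<Sum>c\<in>ends_at G v. flux k a c)) = \<dots>" .
  have edge: "edge_energy k l (a1 + t * b1) (a2 + t * b2) = edge_energy k l a1 a2
      - 2 * t * (b1 * (k * (a2 - a1 * cos (k * l)) / sin (k * l)) + b2 * (k * (a1 - a2 * cos (k * l)) / sin (k * l)))
      + t\<^sup>2 * edge_energy k l b1 b2" for l a1 a2 b1 b2
  proof -
    define i where "i = inverse (sin (k * l))"
    show ?thesis
      unfolding edge_energy_def divide_inverse i_def[symmetric]
      by (simp add: algebra_simps power2_eq_square)
  qed
  show ?thesis
    unfolding pair energy_def edge
    by (simp add: flux_def sum.distrib sum_subtractf flip: sum_distrib_left)
qed

lemma energy_scale: "energy k (\<lambda>v. t * a v) = t\<^sup>2 * energy k a"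
  unfolding energy_def sum_distrib_left edge_energy_def
  by (intro sum.cong refl) (simp add: algebra_simps power2_eq_square)

text \<open>
  Discrete Picone identity: testing the superharmonicity of \<open>w\<close> with \<open>a\<^sup>2 / w\<close> reproduces the energy
  of \<open>a\<close> up to a square on every edge, which measures how much \<open>a / w\<close> varies along it.
\<close>
lemma energy_nonneg_if_supersolution:
  assumes k: "0 < k" and kl: "\<And>e. e \<in> arcs G \<Longrightarrow> k * len e < pi"
    and pos: "\<And>v. v \<in> verts G \<Longrightarrow> 0 < w v"
    and super: "\<And>v. v \<in> F \<Longrightarrow> (\<Sum>c\<in>ends_at G v. flux k w c) \<le> 0"
    and supp: "\<And>v. v \<notin> F \<Longrightarrow> a v = 0"
  shows "0 \<le> energy k a"
proof -
  have s: "0 < sin (k * len e)" if "e \<in> arcs G" for e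
    using that k kl len_pos by (intro sin_gt_zero) auto
  have "0 \<le> (\<Sum>v\<in>verts G. - ((a v)\<^sup>2 / w v) * (\<Sum>c\<in>ends_at G v. flux k w c))"
  proof (rule sum_nonneg)
    fix v assume v: "v \<in> verts G"
    show "0 \<le> - ((a v)\<^sup>2 / w v) * (\<Sum>c\<in>ends_at G v. flux k w c)"
    proof (cases "v \<in> F")
      case True
      then show ?thesis using super[OF True] pos[OF v] by (intro mult_nonpos_nonpos) (auto intro: less_imp_le)
    qed (simp add: supp)
  qed
  also have "\<dots> = (\<Sum>v\<in>verts G. \<Sum>c\<in>ends_at G v. - ((a (tail ends c))\<^sup>2 / w (tail ends c)) * flux k w c)"
    by (auto simp: sum_distrib_left in_ends_at intro!: sum.cong)
  also have "\<dots> = (\<Sum>e\<in>arcs G. - ((a (tail G e))\<^sup>2 / w (tail G e)) * flux k w (e, True)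
                    + - ((a (head G e))\<^sup>2 / w (head G e)) * flux k w (e, False))"
    by (simp only: sum_over_ends ends_simps)
  also have "\<dots> \<le> energy k a"
    unfolding energy_def
  proof (rule sum_mono)
    fix e assume e: "e \<in> arcs G"
    define p q x y where "p = w (tail G e)" "q = w (head G e)" "x = a (tail G e)" "y = a (head G e)"
    note d = this
    have pq: "0 < p" "0 < q" using pos e by (auto simp: d)
    have "edge_energy k (len e) x y - (- (x\<^sup>2 / p) * (k * (q - p * cos (k * len e)) / sin (k * len e))
        + - (y\<^sup>2 / q) * (k * (p - q * cos (k * len e)) / sin (k * len e)))
       = k / sin (k * len e) * ((x * q - y * p)\<^sup>2 / (p * q))"
      using pq s[OF e] unfolding edge_energy_def
      by (simp add: field_simps power2_eq_square)
    also have "\<dots> \<ge> 0" using pq s[OF e] k by (intro mult_nonneg_nonneg divide_nonneg_pos) auto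
    finally show "- ((a (tail G e))\<^sup>2 / w (tail G e)) * flux k w (e, True)
        + - ((a (head G e))\<^sup>2 / w (head G e)) * flux k w (e, False)
        \<le> edge_energy k (len e) (a (tail G e)) (a (head G e))"
      by (simp add: flux_def d)
  qed
  finally show ?thesis .
qed

definition free_verts :: "('v \<Rightarrow> vertex_condition) \<Rightarrow> 'v set" where
  "free_verts bc = {v \<in> verts G. bc v \<noteq> Dirichlet}"

definition nonneg_energy :: "('v \<Rightarrow> vertex_condition) \<Rightarrow> real \<Rightarrow> bool" where
  "nonneg_energy bc k \<longleftrightarrow> (\<forall>a. (\<forall>v. v \<notin> free_verts bc \<longrightarrow> a v = 0) \<longrightarrow> 0 \<le> energy k a)"

text \<open>
  The vertex conditions make the total boundary flux of an eigenfunction vanish, whereas an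
  eigenfunction to \<open>lam < k\<^sup>2\<close> would have a flux greater than the energy of its vertex values.
\<close>
lemma no_eigenvalue_below:
  assumes k: "0 < k" and kl: "\<And>e. e \<in> arcs G \<Longrightarrow> k * len e < pi"
    and neu: "\<And>v. v \<in> verts G \<Longrightarrow> bc v = Neumann \<Longrightarrow> card (ends_at G v) = 1"
    and nonneg: "nonneg_energy bc k"
    and eig: "laplace_eigenvalue G len bc lam"
  shows "k\<^sup>2 \<le> lam"
proof (rule ccontr)
  assume "\<not> k\<^sup>2 \<le> lam"
  then have lam: "lam < k\<^sup>2" by simp
  obtain u u' u'' where
    ode: "\<And>e x. e \<in> arcs G \<Longrightarrow> x \<in> {0..len e} \<Longrightarrow>
        (u e has_real_derivative u' e x) (at x within {0..len e})"
      "\<And>e x. e \<in> arcs G \<Longrightarrow> x \<in> {0..len e} \<Longrightarrow>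
        (u' e has_real_derivative u'' e x) (at x within {0..len e})"
      "\<And>e x. e \<in> arcs G \<Longrightarrow> x \<in> {0..len e} \<Longrightarrow> - u'' e x = lam * u e x"
    and bcs: "\<And>v. v \<in> verts G \<Longrightarrow> satisfies_condition G len u u' v (bc v)"
    and nz: "\<exists>e \<in> arcs G. \<exists>x \<in> {0..len e}. u e x \<noteq> 0"
    using eig unfolding laplace_eigenvalue_def by blast
  \<comment> \<open>Any end at a vertex may be chosen: its ends agree by continuity, and a Neumann vertex has only one.\<close>
  define a where "a v = (if v \<in> free_verts bc \<and> ends_at G v \<noteq> {}
                          then end_value len u (SOME c. c \<in> ends_at G v) else 0)" for v
  have val: "end_value len u c = a v" if v: "v \<in> verts G" and c: "c \<in> ends_at G v" for v c
  proof (cases "bc v")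
    case Dirichlet
    then show ?thesis using bcs[OF v] c by (simp add: a_def free_verts_def)
  next
    case Natural
    have "(SOME c. c \<in> ends_at G v) \<in> ends_at G v" using c by (rule someI)
    then have "end_value len u c = end_value len u (SOME c. c \<in> ends_at G v)"
      using bcs[OF v] c unfolding Natural satisfies_condition.simps by blast
    moreover have "a v = end_value len u (SOME c. c \<in> ends_at G v)"
      using c v Natural unfolding a_def free_verts_def by auto
    ultimately show ?thesis by simp
  next
    case Neumann
    have "(SOME c. c \<in> ends_at G v) \<in> ends_at G v" using c by (rule someI)
    then have "(SOME c. c \<in> ends_at G v) = c"
      using neu[OF v Neumann] c by (metis card_1_singletonE singletonD)
    moreover have "a v = end_value len u (SOME c. c \<in> ends_at G v)"
      using c v Neumann unfolding a_def free_verts_def by auto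
    ultimately show ?thesis by simp
  qed
  have "(\<Sum>c\<in>ends_at G v. end_value len u c * end_deriv len u' c) = 0" if v: "v \<in> verts G" for v
  proof (cases "bc v")
    case Natural
    have "(\<Sum>c\<in>ends_at G v. end_value len u c * end_deriv len u' c)
        = a v * (\<Sum>c\<in>ends_at G v. end_deriv len u' c)"
      using val[OF v] by (simp add: sum_distrib_left)
    moreover have "(\<Sum>c\<in>ends_at G v. end_deriv len u' c) = 0"
      using bcs[OF v] unfolding Natural satisfies_condition.simps by blast
    ultimately show ?thesis by simp
  qed (use bcs[OF v] in auto)
  then have "0 = (\<Sum>v\<in>verts G. \<Sum>c\<in>ends_at G v. end_value len u c * end_deriv len u' c)" by simp
  also have "\<dots> = (\<Sum>e\<in>arcs G. u e 0 * u' e 0 - u e (len e) * u' e (len e))"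
    by (simp add: sum_over_ends end_value_def end_deriv_def)
  also have "\<dots> = - (\<Sum>e\<in>arcs G. u e (len e) * u' e (len e) - u e 0 * u' e 0)"
    by (simp add: sum_subtractf)
  finally have zero: "(\<Sum>e\<in>arcs G. u e (len e) * u' e (len e) - u e 0 * u' e 0) = 0" by simp
  have at: "u e 0 = a (tail G e)" "u e (len e) = a (head G e)" if e: "e \<in> arcs G" for e
    using val[of "tail G e" "(e, True)"] val[of "head G e" "(e, False)"] e
    by (simp_all add: in_ends_at in_arcs_ends end_value_def)
  note flux = edge_energy_le_flux[OF k len_pos kl lam ode]
  obtain e where e: "e \<in> arcs G" "\<exists>x \<in> {0..len e}. u e x \<noteq> 0" using nz by blast
  have "energy k a < (\<Sum>e\<in>arcs G. u e (len e) * u' e (len e) - u e 0 * u' e 0)"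
    unfolding energy_def
  proof (rule sum_strict_mono_ex1)
    show "\<forall>e\<in>arcs G. edge_energy k (len e) (a (tail G e)) (a (head G e))
        \<le> u e (len e) * u' e (len e) - u e 0 * u' e 0"
      using flux(1) at by metis
    show "\<exists>e\<in>arcs G. edge_energy k (len e) (a (tail G e)) (a (head G e))
        < u e (len e) * u' e (len e) - u e 0 * u' e 0"
      using flux(2) at e by metis
  qed simp
  moreover have "0 \<le> energy k a"
    using nonneg unfolding nonneg_energy_def by (auto simp: a_def)
  ultimately show False using zero by simp
qed

text \<open>
  A null vector minimises a nonnegative form, so its first variation vanishes at every free vertex.
  That is the Kirchhoff condition for the interpolating solutions of \<open>- u'' = k\<^sup>2 * u\<close>.
\<close>
lemma eigenvalue_if_null_vector:
  assumes k: "0 < k" and kl: "\<And>e. e \<in> arcs G \<Longrightarrow> k * len e < pi"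
    and neu: "\<And>v. v \<in> verts G \<Longrightarrow> bc v = Neumann \<Longrightarrow> card (ends_at G v) = 1"
    and nonneg: "nonneg_energy bc k"
    and supp: "\<And>v. v \<notin> free_verts bc \<Longrightarrow> a v = 0"
    and null: "energy k a = 0" and nz: "a z \<noteq> 0" "ends_at G z \<noteq> {}"
  shows "laplace_eigenvalue G len bc (k\<^sup>2)"
proof -
  have s: "0 < sin (k * len e)" if "e \<in> arcs G" for e
    using that k kl len_pos by (intro sin_gt_zero) auto
  have kirchhoff: "(\<Sum>c\<in>ends_at G v. flux k a c) = 0" if v: "v \<in> free_verts bc" for v
  proof (rule ccontr)
    define b :: "'v \<Rightarrow> real" where "b = (\<lambda>w. of_bool (w = v))"
    define K where "K = (\<Sum>c\<in>ends_at G v. flux k a c)"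
    assume "\<not> ?thesis"
    then have K: "K \<noteq> 0" by (simp add: K_def)
    have "(\<Sum>w\<in>verts G. b w * (\<Sum>c\<in>ends_at G w. flux k a c)) = K"
      using v by (simp add: b_def K_def free_verts_def of_bool_def if_distrib[of "\<lambda>x. x * _"] cong: if_cong)
    then have quad: "0 \<le> - 2 * t * K + t\<^sup>2 * energy k b" for t
      using nonneg supp null v energy_add_scaled[of k a t b] unfolding nonneg_energy_def
      by (auto simp: b_def dest!: spec[of _ "\<lambda>w. a w + t * b w"])
    define B where "B = \<bar>energy k b\<bar> + 1"
    have B: "0 < B" "energy k b \<le> B" by (auto simp: B_def)
    \<comment> \<open>A small step against a nonzero first variation would make the energy negative.\<close>
    have "0 \<le> - 2 * (K / B) * K + (K / B)\<^sup>2 * energy k b" by (rule quad)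
    also have "\<dots> \<le> - 2 * (K / B) * K + (K / B)\<^sup>2 * B" using B by (intro add_left_mono mult_left_mono) auto
    also have "\<dots> = - (K\<^sup>2 / B)" using B by (simp add: field_simps power2_eq_square)
    also have "\<dots> < 0" using B K by simp
    finally show False by simp
  qed
  define u where "u e x = (a (tail G e) * sin (k * (len e - x)) + a (head G e) * sin (k * x)) / sin (k * len e)" for e x
  define u' where "u' e x = k * (- a (tail G e) * cos (k * (len e - x)) + a (head G e) * cos (k * x)) / sin (k * len e)" for e x
  define u'' where "u'' e x = - k\<^sup>2 * u e x" for e x
  have du: "(u e has_real_derivative u' e x) (at x within S)" for e x S
    unfolding u_def u'_def divide_inverse
    by (auto intro!: derivative_eq_intros simp: algebra_simps)
  have du': "(u' e has_real_derivative u'' e x) (at x within S)" for e x S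
    unfolding u_def u'_def u''_def divide_inverse
    by (auto intro!: derivative_eq_intros simp: algebra_simps power2_eq_square)
  have val: "end_value len u c = a (tail ends c)" if "c \<in> arcs ends" for c
    using that s[of "fst c"]
    by (cases c; cases "snd c") (auto simp: end_value_def u_def in_arcs_ends)
  have der: "end_deriv len u' c = flux k a c" if "c \<in> arcs ends" for c
    using that s[of "fst c"]
    by (cases c; cases "snd c") (auto simp: end_deriv_def u'_def flux_def in_arcs_ends field_simps)
  have sumder: "(\<Sum>c\<in>ends_at G v. end_deriv len u' c) = (\<Sum>c\<in>ends_at G v. flux k a c)" for v
    by (intro sum.cong) (auto simp: der in_ends_at)
  have sat: "satisfies_condition G len u u' v (bc v)" if v: "v \<in> verts G" for v
  proof (cases "bc v")
    case Natural
    then show ?thesis using kirchhoff[of v] v sumder[of v] by (auto simp: free_verts_def val in_ends_at)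
  next
    case Dirichlet
    then show ?thesis using supp[of v] by (auto simp: free_verts_def val in_ends_at)
  next
    case Neumann
    then obtain c where "ends_at G v = {c}" using neu[OF v] by (metis card_1_singletonE)
    then show ?thesis using Neumann kirchhoff[of v] v sumder[of v] by (simp add: free_verts_def)
  qed
  obtain c where c: "c \<in> ends_at G z" using nz by blast
  then have "end_value len u c \<noteq> 0" using nz val by (auto simp: in_ends_at)
  then have "\<exists>x\<in>{0..len (fst c)}. u (fst c) x \<noteq> 0"
    using len_pos[of "fst c"] c
    by (cases c; cases "snd c") (force simp: end_value_def in_ends_at in_arcs_ends)+
  moreover have "fst c \<in> arcs G" using c by (simp add: in_ends_at in_arcs_ends)
  ultimately have "\<exists>e\<in>arcs G. \<exists>x\<in>{0..len e}. u e x \<noteq> 0" by blast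
  then show ?thesis
    unfolding laplace_eigenvalue_def using du du' sat
    by (intro exI[of _ u] exI[of _ u'] exI[of _ u'']) (auto simp: u''_def)
qed

end

section \<open>The first eigenvalue is attained\<close>

lemma square_le_if_all_smaller:
  fixes K m :: real
  assumes "0 < K" "\<And>k. 0 < k \<Longrightarrow> k < K \<Longrightarrow> k\<^sup>2 \<le> m"
  shows "K\<^sup>2 \<le> m"
proof (rule continuous_le_on_closure[of "{0<..<K}" "\<lambda>k. k\<^sup>2"])
  show "K \<in> closure {0<..<K}" using assms by simp
qed (use assms in \<open>auto intro!: continuous_intros\<close>)

lemma x_cos_le_sin: "x * cos x \<le> sin x" if "0 \<le> x" "x \<le> pi" for x :: real
proof -
  have "sin 0 - 0 * cos 0 \<le> sin x - x * cos x"
  proof (rule DERIV_nonneg_imp_nondecreasing[OF that(1)])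
    fix t assume t: "0 \<le> t" "t \<le> x"
    have "((\<lambda>t. sin t - t * cos t) has_real_derivative t * sin t) (at t)"
      by (auto intro!: derivative_eq_intros)
    moreover have "0 \<le> t * sin t" using t that by (intro mult_nonneg_nonneg sin_ge_zero) auto
    ultimately show "\<exists>y. ((\<lambda>t. sin t - t * cos t) has_real_derivative y) (at t) \<and> 0 \<le> y" by blast
  qed
  then show ?thesis by simp
qed

context finite_metric_graph
begin

lemma continuous_on_energy:
  fixes S :: "'p :: topological_space set"
  assumes k: "\<And>p. p \<in> S \<Longrightarrow> 0 < f p" and kl: "\<And>p e. p \<in> S \<Longrightarrow> e \<in> arcs G \<Longrightarrow> f p * len e < pi"
    and f: "continuous_on S f" and h: "\<And>v. continuous_on S (\<lambda>p. h p v)"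
  shows "continuous_on S (\<lambda>p. energy (f p) (h p))"
proof -
  have "continuous_on S (\<lambda>p. edge_energy (f p) (len e) (h p (tail G e)) (h p (head G e)))"
    if e: "e \<in> arcs G" for e
  proof -
    have cos: "continuous_on UNIV (cos :: real \<Rightarrow> real)" and sin: "continuous_on UNIV (sin :: real \<Rightarrow> real)"
      by (intro continuous_intros)+
    have c: "continuous_on S (\<lambda>p. f p * len e)" by (intro continuous_intros f)
    have "\<forall>p\<in>S. sin (f p * len e) \<noteq> 0"
      using k kl e len_pos[OF e] by (metis less_irrefl mult_pos_pos sin_gt_zero)
    then show ?thesis
      unfolding edge_energy_def
      by (intro continuous_intros f h continuous_on_compose2[OF cos c] continuous_on_compose2[OF sin c]) auto
  qed
  then show ?thesis unfolding energy_def by (rule continuous_on_sum)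
qed

text \<open>
  The topology is the product topology. Tychonoff's theorem replaces a choice of coordinates on the
  space of vertex values.
\<close>
lemma compact_bounded_vectors:
  "compact {a :: 'v \<Rightarrow> real. (\<forall>v. v \<notin> F \<longrightarrow> a v = 0) \<and> (\<forall>v. a v \<in> {-1..1})}"
proof -
  define S where "S v = (if v \<in> F then {-1..1} else {0 :: real})" for v :: 'v
  have "compactin (product_topology (\<lambda>_. euclidean) UNIV) (PiE UNIV S)"
    unfolding compactin_PiE by (auto simp: S_def)
  moreover have "PiE UNIV S = {a :: 'v \<Rightarrow> real. (\<forall>v. v \<notin> F \<longrightarrow> a v = 0) \<and> (\<forall>v. a v \<in> {-1..1})}"
  proof -
    have S: "x \<in> S v \<longleftrightarrow> (v \<notin> F \<longrightarrow> x = 0) \<and> x \<in> {-1..1}" for x v by (auto simp: S_def)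
    show ?thesis unfolding PiE_UNIV_domain Pi_def S by blast
  qed
  ultimately show ?thesis by (simp add: euclidean_product_topology)
qed

text \<open>
  The parameters in \<open>{k0..k1}\<close> at which some unit vector has energy at most zero form a compact set,
  the projection of a compact set of pairs. At its least element the energy is nonnegative, as
  the limit of nonnegative energies (or by hypothesis, at \<open>k0\<close>), hence zero at such a unit vector.
\<close>
lemma first_null_vector:
  assumes k0: "0 < k0" "k0 \<le> k1" and kl: "\<And>e. e \<in> arcs G \<Longrightarrow> k1 * len e < pi"
    and nonneg: "nonneg_energy bc k0"
    and a1: "\<And>v. v \<notin> free_verts bc \<Longrightarrow> a1 v = 0" and neg: "energy k1 a1 < 0"
  obtains k a v where "k0 \<le> k" "k \<le> k1" "nonneg_energy bc k"
    "\<And>v. v \<notin> free_verts bc \<Longrightarrow> a v = 0" "energy k a = 0" "v \<in> free_verts bc" "a v \<noteq> 0"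
proof -
  define F where "F = free_verts bc"
  have fin: "finite F" by (simp add: F_def free_verts_def)
  define X where "X = {a :: 'v \<Rightarrow> real. (\<forall>v. v \<notin> F \<longrightarrow> a v = 0) \<and> (\<forall>v. a v \<in> {-1..1})}"
  define N where "N a = (\<Sum>v\<in>F. (a v)\<^sup>2)" for a :: "'v \<Rightarrow> real"
  define T where "T = ({k0..k1} \<times> X) \<inter> {p \<in> {k0..k1} \<times> UNIV. energy (fst p) (snd p) \<le> 0}
      \<inter> {p \<in> UNIV. N (snd p) = 1}"
  have small: "k * len e < pi" if "k \<le> k1" "e \<in> arcs G" for k e
    using kl[OF that(2)] len_pos[OF that(2)] that(1) by (meson le_less_trans less_imp_le mult_right_mono)
  have coord: "continuous_on S (\<lambda>p :: real \<times> ('v \<Rightarrow> real). snd p v)" for S v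
    by (rule continuous_on_product_then_coordinatewise) (intro continuous_intros)
  have "compact T"
  proof -
    have "compact ({k0..k1} \<times> X)"
      using compact_bounded_vectors by (auto simp: X_def intro!: compact_Times)
    moreover have "continuous_on ({k0..k1} \<times> UNIV) (\<lambda>p. energy (fst p) (snd p))"
      by (rule continuous_on_energy) (use k0 small coord in \<open>auto intro!: continuous_intros\<close>)
    then have "closed {p \<in> {k0..k1} \<times> UNIV. energy (fst p) (snd p) \<le> 0}"
      by (intro continuous_on_closed_Collect_le closed_Times continuous_on_const) auto
    moreover have "closed {p \<in> (UNIV :: (real \<times> ('v \<Rightarrow> real)) set). N (snd p) = 1}"
      unfolding N_def by (intro continuous_closed_preimage_constant continuous_intros coord)
    ultimately show ?thesis unfolding T_def by (intro compact_Int_closed)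
  qed
  then have comp: "compact (fst ` T)" by (intro compact_continuous_image continuous_intros)
  have in_T: "k \<in> fst ` T" if k: "k0 \<le> k" "k \<le> k1" and b: "\<And>v. v \<notin> F \<Longrightarrow> b v = 0"
      "energy k b \<le> 0" "w \<in> F" "b w \<noteq> 0" for k b w
  proof -
    have "0 < (b w)\<^sup>2" using b by simp
    also have "\<dots> \<le> N b" unfolding N_def by (rule member_le_sum) (use b fin in auto)
    finally have N: "0 < N b" .
    define t where "t = 1 / sqrt (N b)"
    have t2: "t\<^sup>2 = 1 / N b" using N by (simp add: t_def power_divide)
    define c where "c = (\<lambda>v. t * b v)"
    have "N c = t\<^sup>2 * N b" by (simp add: N_def c_def power_mult_distrib sum_distrib_left)
    then have Nc: "N c = 1" using N t2 by simp
    have c_supp: "c v = 0" if "v \<notin> F" for v using b that by (simp add: c_def)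
    have "c v \<in> {-1..1}" for v
    proof (cases "v \<in> F")
      case True
      have "(c v)\<^sup>2 \<le> N c" unfolding N_def by (rule member_le_sum) (use True fin in auto)
      then have "(c v)\<^sup>2 \<le> 1" using Nc by simp
      then show ?thesis by (simp add: abs_square_le_1 abs_le_iff)
    qed (simp add: c_supp)
    moreover have "energy k c \<le> 0"
      unfolding c_def energy_scale using b(2) by (simp add: mult_nonneg_nonpos)
    ultimately have "(k, c) \<in> T" using k Nc c_supp by (auto simp: T_def X_def)
    then show ?thesis by force
  qed
  obtain w1 where w1: "w1 \<in> F" "a1 w1 \<noteq> 0"
  proof (rule ccontr)
    assume "\<not> thesis"
    then have "a1 = (\<lambda>v. 0 * a1 v)" using that a1 by (auto simp: F_def)
    then show False using neg energy_scale[of k1 0 a1] by simp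
  qed
  have "k1 \<in> fst ` T" using in_T[of k1 a1 w1] k0 a1 neg w1 by (auto simp: F_def)
  then obtain k where k: "k \<in> fst ` T" and least: "\<And>k'. k' \<in> fst ` T \<Longrightarrow> k \<le> k'"
    using compact_attains_inf[OF comp] by blast
  then obtain a where a: "(k, a) \<in> T" by force
  then have a': "k0 \<le> k" "k \<le> k1" "\<And>v. v \<notin> F \<Longrightarrow> a v = 0" "energy k a \<le> 0" "N a = 1"
    by (auto simp: T_def X_def)
  have "\<exists>v \<in> F. a v \<noteq> 0"
  proof (rule ccontr)
    assume "\<not> ?thesis"
    then have "N a = 0" by (simp add: N_def)
    then show False using a' by simp
  qed
  then obtain v where v: "v \<in> F" "a v \<noteq> 0" by blast
  have "nonneg_energy bc k"
  proof (cases "k = k0")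
    case False
    then have lt: "k0 < k" using a' by simp
    have clos: "closure {k0..<k} = {k0..k}" using lt by simp
    show ?thesis
      unfolding nonneg_energy_def
    proof (intro allI impI)
      fix b :: "'v \<Rightarrow> real" assume b: "\<forall>v. v \<notin> free_verts bc \<longrightarrow> b v = 0"
      show "0 \<le> energy k b"
      proof (rule continuous_ge_on_closure[of "{k0..<k}" "\<lambda>k. energy k b"])
        show "continuous_on (closure {k0..<k}) (\<lambda>k. energy k b)"
          unfolding clos
          by (rule continuous_on_energy) (use k0 small a' in \<open>auto intro!: continuous_intros\<close>)
        show "k \<in> closure {k0..<k}" using clos lt by simp
        fix k' assume k': "k' \<in> {k0..<k}"
        show "0 \<le> energy k' b"
        proof (rule ccontr)
          assume neg': "\<not> 0 \<le> energy k' b"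
          obtain w where "w \<in> F" "b w \<noteq> 0"
          proof (rule ccontr)
            assume "\<not> thesis"
            then have "b = (\<lambda>v. 0 * b v)" using that b by (auto simp: F_def)
            then show False using neg' energy_scale[of k' 0 b] by simp
          qed
          then have "k' \<in> fst ` T" using in_T[of k' b w] b neg' k' a' by (auto simp: F_def)
          then show False using least k' by fastforce
        qed
      qed
    qed
  qed (use nonneg in simp)
  moreover from this have "energy k a = 0"
    using a' by (auto simp: nonneg_energy_def F_def intro!: antisym)
  ultimately show ?thesis using that[of k a v] a' v by (auto simp: F_def)
qed

text \<open>
  The energy of the indicator of \<open>v\<close> is the sum of \<open>k * cot (k * len f)\<close> over the edges \<open>f\<close> at \<open>v\<close>. Every
  term is at most \<open>1 / len f\<close>, and the term of a longest edge tends to minus infinity as its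
  argument tends to \<open>pi\<close>.
\<close>
lemma indicator_energy_negative:
  assumes e: "e \<in> arcs G" and longest: "\<And>f. f \<in> arcs G \<Longrightarrow> len f \<le> len e"
    and v: "v = tail G e \<or> v = head G e" and loopless: "\<And>f. f \<in> arcs G \<Longrightarrow> tail G f \<noteq> head G f"
  obtains k where "0 < k" "k * len e < pi" "energy k (\<lambda>w. of_bool (w = v)) < 0"
proof -
  define C where "C = (\<Sum>f\<in>arcs G. 1 / len f)"
  define m where "m = len e * C + 1"
  \<comment> \<open>Chosen so that the cotangent of \<open>k * len e\<close> is exactly \<open>- m\<close>.\<close>
  define k where "k = (pi / 2 + arctan m) / len e"
  have l: "0 < len e" using e len_pos by blast
  have C: "0 \<le> C" unfolding C_def by (intro sum_nonneg) (use len_pos in \<open>auto intro: less_imp_le\<close>)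
  have m: "0 < m" using l C by (simp add: m_def add_nonneg_pos)
  then have at: "0 < arctan m" "arctan m < pi / 2" using arctan_ubound by auto
  have kl: "k * len e = pi / 2 + arctan m" using l by (simp add: k_def)
  have kle: "k * len e < pi" "1 < k * len e"
    using at pi_gt3 unfolding kl by linarith+
  have "0 < k" using l at pi_gt3 by (simp add: k_def add_pos_pos)
  note k = this kle
  have kf: "0 < k * len f" "k * len f < pi" if "f \<in> arcs G" for f
    using k len_pos[OF that] mult_left_mono[OF longest[OF that], of k] by (simp, linarith)
  define b :: "'v \<Rightarrow> real" where "b = (\<lambda>w. of_bool (w = v))"
  have bound: "edge_energy k (len f) (b (tail G f)) (b (head G f)) \<le> 1 / len f" if f: "f \<in> arcs G" for f
  proof -
    have s: "0 < sin (k * len f)" using kf[OF f] by (intro sin_gt_zero)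
    have "k * len f * cos (k * len f) \<le> sin (k * len f)" using kf[OF f] by (intro x_cos_le_sin) auto
    then have "k * cos (k * len f) / sin (k * len f) \<le> 1 / len f"
      using s len_pos[OF f] by (simp add: field_simps)
    moreover have "0 \<le> 1 / len f" using len_pos[OF f] by simp
    ultimately show ?thesis using loopless[OF f] by (auto simp: edge_energy_def b_def of_bool_def)
  qed
  have "edge_energy k (len e) (b (tail G e)) (b (head G e)) = k * cos (k * len e) / sin (k * len e)"
    using v loopless[OF e] by (auto simp: edge_energy_def b_def)
  also have "\<dots> = - (k * m)"
  proof -
    have "cos (k * len e) = - sin (arctan m)" "sin (k * len e) = cos (arctan m)"
      by (simp_all add: kl cos_add sin_add)
    moreover have "sin (arctan m) / cos (arctan m) = m" using tan_arctan[of m] by (simp add: tan_def)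
    ultimately show ?thesis by (metis minus_divide_left mult_minus_right times_divide_eq_right)
  qed
  also have "\<dots> < - C"
  proof -
    have "C * len e < m * (k * len e)"
    proof -
      have "C * len e < m * 1" by (simp add: m_def mult.commute)
      also have "\<dots> \<le> m * (k * len e)" using m k by (intro mult_left_mono) auto
      finally show ?thesis .
    qed
    then have "C < m * k" using l by (simp add: mult.assoc[symmetric])
    then show ?thesis by (simp add: mult.commute)
  qed
  finally have main: "edge_energy k (len e) (b (tail G e)) (b (head G e)) < - C" .
  have "energy k b = edge_energy k (len e) (b (tail G e)) (b (head G e))
      + (\<Sum>f\<in>arcs G - {e}. edge_energy k (len f) (b (tail G f)) (b (head G f)))"
    unfolding energy_def using e by (intro sum.remove) auto
  also have "\<dots> < - C + (\<Sum>f\<in>arcs G - {e}. 1 / len f)"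
    by (intro add_less_le_mono main sum_mono bound) auto
  also have "\<dots> \<le> - C + C"
    unfolding C_def by (intro add_left_mono sum_mono2) (use len_pos in \<open>auto intro: less_imp_le\<close>)
  finally show ?thesis using that k by (simp add: b_def)
qed

lemma eigenvalue_of_dirichlet_edge:
  assumes e: "e \<in> arcs G"
    and dir: "tail G e \<notin> free_verts bc" "head G e \<notin> free_verts bc"
  shows "laplace_eigenvalue G len bc ((pi / len e)\<^sup>2)"
proof -
  define k where "k = pi / len e"
  have l: "0 < len e" using e len_pos by blast
  have kl: "k * len e = pi" using l by (simp add: k_def)
  define u u' u'' :: "'e \<Rightarrow> real \<Rightarrow> real" where
    "u f x = (if f = e then sin (k * x) else 0)" and
    "u' f x = (if f = e then k * cos (k * x) else 0)" and
    "u'' f x = (if f = e then - (k\<^sup>2 * sin (k * x)) else 0)" for f x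
  have du: "(u f has_real_derivative u' f x) (at x within S)" for f x S
    unfolding u_def u'_def by (auto intro!: derivative_eq_intros)
  have du': "(u' f has_real_derivative u'' f x) (at x within S)" for f x S
    unfolding u'_def u''_def by (auto intro!: derivative_eq_intros simp: power2_eq_square)
  have val: "end_value len u c = 0" for c
    by (cases c) (auto simp: end_value_def u_def kl)
  have der: "end_deriv len u' c = 0" if "tail ends c \<in> free_verts bc" for c
  proof -
    have "fst c \<noteq> e" using that dir by (cases c; cases "snd c") auto
    then show ?thesis by (cases c) (auto simp: end_deriv_def u'_def)
  qed
  have "satisfies_condition G len u u' v (bc v)" if v: "v \<in> verts G" for v
  proof (cases "bc v")
    case Natural
    then have "v \<in> free_verts bc" using v by (simp add: free_verts_def)
    then show ?thesis using Natural val der by (simp add: in_ends_at)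
  next
    case Neumann
    then have "v \<in> free_verts bc" using v by (simp add: free_verts_def)
    then show ?thesis using Neumann der by (simp add: in_ends_at)
  qed (simp add: val)
  moreover have "\<exists>f\<in>arcs G. \<exists>x\<in>{0..len f}. u f x \<noteq> 0"
  proof (intro bexI[of _ e] bexI[of _ "len e / 2"] e)
    have "k * (len e / 2) = pi / 2" using kl by simp
    then show "u e (len e / 2) \<noteq> 0" by (simp add: u_def)
  qed (use l in auto)
  ultimately have "laplace_eigenvalue G len bc (k\<^sup>2)"
    unfolding laplace_eigenvalue_def using du du'
    by (intro exI[of _ u] exI[of _ u'] exI[of _ u'']) (auto simp: u_def u''_def)
  then show ?thesis by (simp add: k_def)
qed

text \<open>
  A least element is only meaningful if there is one. Here it is the square of the first degenerate
  parameter, or \<open>(pi / l)\<^sup>2\<close> for the greatest edge length \<open>l\<close> if the form does not become negative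
  before.
\<close>
lemma first_eigenvalue_is_eigenvalue:
  assumes k0: "0 < k0" and kl: "\<And>e. e \<in> arcs G \<Longrightarrow> k0 * len e < pi"
    and nonneg: "\<And>k. 0 < k \<Longrightarrow> k \<le> k0 \<Longrightarrow> nonneg_energy bc k"
    and neu: "\<And>v. v \<in> verts G \<Longrightarrow> bc v = Neumann \<Longrightarrow> card (ends_at G v) = 1"
    and loopless: "\<And>f. f \<in> arcs G \<Longrightarrow> tail G f \<noteq> head G f"
    and no_isolated: "\<And>v. v \<in> verts G \<Longrightarrow> ends_at G v \<noteq> {}"
  shows "laplace_eigenvalue G len bc (first_eigenvalue G len bc)"
proof -
  have fin: "finite (len ` arcs G)" "len ` arcs G \<noteq> {}" using arcs_nonempty by auto
  obtain e where e: "e \<in> arcs G" "len e = Max (len ` arcs G)" using Max_in[OF fin] by (metis imageE)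
  have longest: "len f \<le> len e" if "f \<in> arcs G" for f using that e fin by simp
  have l: "0 < len e" using e len_pos by blast
  have small: "k * len f < pi" if "0 < k" "k * len e < pi" "f \<in> arcs G" for k f
    using mult_left_mono[OF longest[OF that(3)], of k] that by linarith
  have "\<exists>lam. laplace_eigenvalue G len bc lam \<and> (\<forall>mu. laplace_eigenvalue G len bc mu \<longrightarrow> lam \<le> mu)"
  proof (cases "\<exists>k1. 0 < k1 \<and> k1 * len e < pi \<and> \<not> nonneg_energy bc k1")
    case True
    then obtain k1 a1 where k1: "0 < k1" "k1 * len e < pi" "\<not> nonneg_energy bc k1"
      and a1: "\<And>v. v \<notin> free_verts bc \<Longrightarrow> a1 v = 0" "energy k1 a1 < 0"
      unfolding nonneg_energy_def by (metis not_le)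
    have "k0 \<le> k1" using nonneg k1 by (metis linear)
    from first_null_vector[OF k0 this small[OF k1(1,2)] nonneg[OF k0 order.refl] a1]
    obtain k a v where k: "k0 \<le> k" "k \<le> k1" "nonneg_energy bc k"
      and a: "\<And>v. v \<notin> free_verts bc \<Longrightarrow> a v = 0" "energy k a = 0" "v \<in> free_verts bc" "a v \<noteq> 0"
      by blast
    have kpos: "0 < k" using k0 k by simp
    have "k * len e < pi" using k k1 l by (meson le_less_trans less_imp_le mult_right_mono)
    note sm = small[OF kpos this]
    have "ends_at G v \<noteq> {}" using no_isolated a(3) by (simp add: free_verts_def)
    then have "laplace_eigenvalue G len bc (k\<^sup>2)"
      using eigenvalue_if_null_vector[OF kpos sm neu k(3) a(1,2,4)] by blast
    moreover have "k\<^sup>2 \<le> mu" if "laplace_eigenvalue G len bc mu" for mu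
      using no_eigenvalue_below[OF kpos sm neu k(3) that] by blast
    ultimately show ?thesis by blast
  next
    case False
    have "v \<notin> free_verts bc" if v: "v = tail G e \<or> v = head G e" for v
    proof
      assume free: "v \<in> free_verts bc"
      from indicator_energy_negative[OF e(1) longest v loopless]
      obtain k where "0 < k" "k * len e < pi" "energy k (\<lambda>w. of_bool (w = v)) < 0" by metis
      moreover from this free have "\<not> nonneg_energy bc k"
        unfolding nonneg_energy_def by (auto intro!: exI[of _ "\<lambda>w. of_bool (w = v)"])
      ultimately show False using False by blast
    qed
    then have "laplace_eigenvalue G len bc ((pi / len e)\<^sup>2)"
      using eigenvalue_of_dirichlet_edge[OF e(1)] by blast
    moreover have "(pi / len e)\<^sup>2 \<le> mu" if mu: "laplace_eigenvalue G len bc mu" for mu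
    proof -
      have below: "k\<^sup>2 \<le> mu" if "0 < k" "k < pi / len e" for k
      proof -
        have ke: "k * len e < pi" using that l by (simp add: field_simps)
        then have "nonneg_energy bc k" using False that by blast
        then show ?thesis using no_eigenvalue_below[OF that(1) small[OF that(1) ke] neu _ mu] by blast
      qed
      show ?thesis
        by (rule square_le_if_all_smaller) (use below l in auto)
    qed
    ultimately show ?thesis by blast
  qed
  then show ?thesis unfolding first_eigenvalue_def by (metis (mono_tags, lifting) LeastI2_order)
qed

end

section \<open>Reduced walks and distances in a tree\<close>

definition reduced :: "('e \<times> bool) list \<Rightarrow> bool" where
  "reduced = successively (\<lambda>a b. b \<noteq> opposite_end a)"

definition reverse_walk :: "('e \<times> bool) list \<Rightarrow> ('e \<times> bool) list" where
  "reverse_walk p = rev (map opposite_end p)"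

lemma reduced_append:
  "reduced (p @ q) \<longleftrightarrow> reduced p \<and> reduced q
     \<and> (p = [] \<or> q = [] \<or> hd q \<noteq> opposite_end (last p))"
  by (auto simp: reduced_def successively_append_iff)

lemma reduced_simps [simp]: "reduced []" "reduced [a]"
  by (simp_all add: reduced_def)

lemma reduced_reverse_walk: "reduced (reverse_walk p) \<longleftrightarrow> reduced p"
  unfolding reduced_def reverse_walk_def successively_rev successively_map
  by (intro successively_cong) (metis opposite_end_simps(1))+

locale finite_metric_tree = finite_metric_graph G len
  for G :: "('v, 'e) pre_digraph" and len :: "'e \<Rightarrow> real" +
  assumes connected: "connected G" and acyclic_graph: "acyclic_graph G"
begin

lemma awalk_reverse: "ends.awalk u p v \<Longrightarrow> ends.awalk v (reverse_walk p) u"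
proof (induction p arbitrary: u)
  case Nil
  then show ?case by (auto simp: reverse_walk_def ends.awalk_Nil_iff)
next
  case (Cons a p)
  then have a: "a \<in> arcs ends" "u = tail ends a" and "ends.awalk (head ends a) p v"
    by (auto simp: ends.awalk_Cons_iff)
  then have "ends.awalk v (reverse_walk p) (head ends a)"
    using Cons.IH by blast
  moreover have "ends.awalk (head ends a) [opposite_end a] u"
    using a ends.arc_implies_awalk[of "opposite_end a"] by auto
  ultimately show ?case
    by (simp add: reverse_walk_def ends.awalk_appendI)
qed

text \<open>
  A shortest closed reduced walk would have no repeated vertex and would hence be a cycle. It
  also uses no edge twice: in the same direction this would repeat a vertex, and in opposite
  directions the two uses would have to be adjacent, which reducedness forbids.
\<close>
lemma no_closed_reduced_walk:
  assumes "ends.awalk u p u" "reduced p"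
  shows "p = []"
  using assms
proof (induction "length p" arbitrary: u p rule: less_induct)
  case less
  show ?case
  proof (rule ccontr)
    assume "p \<noteq> []"
    then obtain a q where p: "p = a # q" by (cases p) auto
    have walk: "ends.awalk (head ends a) q u"
      using less.prems(1) unfolding p by (auto simp: ends.awalk_Cons_iff)
    have tl_verts: "tl (ends.awalk_verts u p) = ends.awalk_verts (head ends a) q"
      using p by simp
    show False
    proof (cases "distinct (ends.awalk_verts (head ends a) q)")
      case False
      then obtain q1 r q2 w where q: "q = q1 @ r @ q2" "0 < length r" "ends.awalk w r w"
        using ends.awalk_not_distinct_decomp[OF walk] by blast
      have "reduced r"
        using less.prems(2) q p reduced_append[of "a # q1"] by (simp add: reduced_append)
      moreover have "length r < length p" using p q by simp
      ultimately show False using less.hyps q by blast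
    next
      case True
      then have cyc: "ends.cycle p"
        using less.prems(1) \<open>p \<noteq> []\<close> tl_verts unfolding ends.cycle_def by auto
      have cas: "ends.cas u p u" using less.prems(1) by auto
      have heads: "distinct (map (head ends) p)"
        using True tl_verts ends.awalk_verts_conv'[OF cas] \<open>p \<noteq> []\<close> by simp
      have "tail ends (r ! Suc i) = head ends (r ! i)"
        if "ends.cas w r z" "Suc i < length r" for w r z i
        using that
      proof (induction r arbitrary: w i)
        case (Cons b r)
        then show ?case by (cases i; cases r) auto
      qed auto
      then have consecutive: "tail ends (p ! Suc i) = head ends (p ! i)" if "Suc i < length p" for i
        using cas that by blast
      have "distinct (map fst p)"
      proof (rule ccontr)
        assume "\<not> distinct (map fst p)"
        then obtain i j where ij: "i < j" "j < length p" "fst (p ! i) = fst (p ! j)"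
          by (auto simp: distinct_conv_nth) (metis linorder_neqE_nat)
        have inj: "k = l" if "k < length p" "l < length p" "head ends (p ! k) = head ends (p ! l)" for k l
          using heads that by (auto simp: distinct_conv_nth)
        have "p ! j \<noteq> p ! i" using inj[of i j] ij by auto
        then have opp: "p ! j = opposite_end (p ! i)"
          using ij by (auto simp: opposite_end_def prod_eq_iff)
        obtain j' where j': "j = Suc j'" using ij by (cases j) auto
        have "head ends (p ! j') = head ends (p ! i)"
          using consecutive[of j'] ij j' opp by simp
        then have "j' = i" using inj ij j' by auto
        then have "p ! Suc i = opposite_end (p ! i)" using opp j' by simp
        then show False
          using less.prems(2) ij j' \<open>j' = i\<close>
          by (auto simp: reduced_def successively_conv_nth)
      qed
      then show False using cyc acyclic_graph unfolding acyclic_graph_def by blast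
    qed
  qed
qed

text \<open>
  Two reduced walks with the same ends share their last arc, for otherwise the first followed by the
  reversal of the second would be a closed reduced walk.
\<close>
lemma reduced_walk_unique:
  assumes "ends.awalk u p v" "ends.awalk u q v" "reduced p" "reduced q"
  shows "p = q"
  using assms
proof (induction p arbitrary: q v rule: rev_induct)
  case Nil
  then have "u = v" by (simp add: ends.awalk_Nil_iff)
  then show ?case using no_closed_reduced_walk Nil by blast
next
  case (snoc a p)
  show ?case
  proof (cases q rule: rev_cases)
    case Nil
    then have "u = v" using snoc.prems by (simp add: ends.awalk_Nil_iff)
    then show ?thesis using no_closed_reduced_walk snoc.prems by blast
  next
    case (snoc q' b)
    have p: "ends.awalk u p (tail ends a)" "head ends a = v"
      and q': "ends.awalk u q' (tail ends b)" "head ends b = v"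
      using snoc.prems snoc by (auto simp: ends.awalk_Cons_iff ends.awalk_Nil_iff)
    show ?thesis
    proof (cases "a = b")
      case True
      then have "p = q'"
        using snoc.IH[OF p(1)] q' snoc.prems snoc by (auto simp: reduced_append)
      then show ?thesis using True snoc by simp
    next
      case False
      have "ends.awalk u ((p @ [a]) @ reverse_walk q) u"
        using snoc.prems awalk_reverse ends.awalk_appendI by blast
      moreover have "reduced ((p @ [a]) @ reverse_walk q)"
        using snoc.prems False snoc
        by (subst reduced_append) (auto simp: reduced_reverse_walk, simp add: reverse_walk_def)
      ultimately show ?thesis using no_closed_reduced_walk by blast
    qed
  qed
qed

lemma awalk_cost_nonneg: "ends.awalk u p v \<Longrightarrow> 0 \<le> ends.awalk_cost (len \<circ> fst) p"
  by (rule ends.pos_cost_pos_awalk_cost) (auto intro: less_imp_le len_pos simp: in_arcs_ends)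

lemma reduce_walk:
  assumes "ends.awalk u p v"
  shows "\<exists>q. ends.awalk u q v \<and> reduced q \<and> ends.awalk_cost (len \<circ> fst) q \<le> ends.awalk_cost (len \<circ> fst) p"
  using assms
proof (induction p arbitrary: u)
  case Nil
  then show ?case using reduced_simps(1) by blast
next
  case (Cons a p)
  then have a: "a \<in> arcs ends" "u = tail ends a" and p: "ends.awalk (head ends a) p v"
    by (auto simp: ends.awalk_Cons_iff)
  obtain q where q: "ends.awalk (head ends a) q v" "reduced q"
    "ends.awalk_cost (len \<circ> fst) q \<le> ends.awalk_cost (len \<circ> fst) p"
    using Cons.IH[OF p] by blast
  show ?case
  proof (cases "q \<noteq> [] \<and> hd q = opposite_end a")
    case True
    then obtain r where r: "q = opposite_end a # r" by (cases q) auto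
    have "0 \<le> len (fst a)" using a len_pos[of "fst a"] by (auto simp: in_arcs_ends)
    then have "ends.awalk_cost (len \<circ> fst) r \<le> ends.awalk_cost (len \<circ> fst) (a # p)"
      using q(3) r by simp
    moreover have "ends.awalk u r v" using q(1) r a by (simp add: ends.awalk_Cons_iff)
    moreover have "reduced r" using q(2) r reduced_append[of "[opposite_end a]" r] by simp
    ultimately show ?thesis by blast
  next
    case False
    then have "reduced (a # q)" using q(2) reduced_append[of "[a]" q] by auto
    moreover have "ends.awalk u (a # q) v" using q(1) a by (simp add: ends.awalk_Cons_iff)
    moreover have "ends.awalk_cost (len \<circ> fst) (a # q) \<le> ends.awalk_cost (len \<circ> fst) (a # p)"
      using q(3) by simp
    ultimately show ?thesis by blast
  qed
qed

lemma walk_exists: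
  assumes "u \<in> verts G" "v \<in> verts G"
  shows "\<exists>p. ends.awalk u p v"
proof -
  have "u \<rightarrow>\<^sup>*\<^bsub>with_proj (mk_symmetric G)\<^esub> v"
    using connected assms by (auto simp: connected_def strongly_connected_def)
  then have "(u, v) \<in> rtrancl_on (verts G) (arcs_ends (with_proj (mk_symmetric G)))"
    by (simp add: reachable_def)
  then show ?thesis
  proof (induction rule: rtrancl_on_induct)
    case base
    then show ?case using ends.awalk_Nil_iff by auto
  next
    case (step x y)
    from step(2) obtain e where e: "e \<in> arcs G"
      "(x = tail G e \<and> y = head G e) \<or> (x = head G e \<and> y = tail G e)"
      by (auto simp: arcs_ends_def arc_to_ends_def mk_symmetric_def)
    define a where "a = (e, x = tail G e)"
    have "a \<in> arcs ends" "tail ends a = x" "head ends a = y"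
      using e by (auto simp: a_def ends_graph_def)
    then have "ends.awalk x [a] y" using ends.arc_implies_awalk by blast
    then show ?case using step ends.awalk_appendI by blast
  qed
qed

abbreviation vdist :: "'v \<Rightarrow> 'v \<Rightarrow> real" where
  "vdist \<equiv> vertex_dist G len"

text \<open>
  Every walk can be reduced without increasing its cost, and there is only one reduced walk, so the
  infimum over all walks is attained there.
\<close>
lemma vdist_eq_cost:
  assumes "ends.awalk u p v" "reduced p"
  shows "vdist u v = ends.awalk_cost (len \<circ> fst) p"
proof -
  have "ends.\<mu> (len \<circ> fst) u v = ereal (ends.awalk_cost (len \<circ> fst) p)"
    unfolding ends.\<mu>_def
  proof (rule INF_eqI)
    fix q assume "q \<in> {q. ends.awalk u q v}"
    then obtain r where r: "ends.awalk u r v" "reduced r"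
      "ends.awalk_cost (len \<circ> fst) r \<le> ends.awalk_cost (len \<circ> fst) q"
      using reduce_walk by blast
    moreover have "r = p" using r assms reduced_walk_unique by blast
    ultimately show "ereal (ends.awalk_cost (len \<circ> fst) p) \<le> ereal (ends.awalk_cost (len \<circ> fst) q)" by simp
  next
    fix y assume "\<And>i. i \<in> {q. ends.awalk u q v} \<Longrightarrow> y \<le> ereal (ends.awalk_cost (len \<circ> fst) i)"
    then show "y \<le> ereal (ends.awalk_cost (len \<circ> fst) p)" using assms by blast
  qed
  then show ?thesis by (simp add: vertex_dist_def)
qed

lemma reduced_walkE:
  assumes "u \<in> verts G" "v \<in> verts G"
  obtains p where "ends.awalk u p v" "reduced p" "vdist u v = ends.awalk_cost (len \<circ> fst) p"
  using walk_exists[OF assms] reduce_walk vdist_eq_cost by metis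

lemma vdist_self: "u \<in> verts G \<Longrightarrow> vdist u u = 0"
  using vdist_eq_cost[of u "[]" u] by (simp add: ends.awalk_Nil_iff)

lemma vdist_nonneg: "u \<in> verts G \<Longrightarrow> v \<in> verts G \<Longrightarrow> 0 \<le> vdist u v"
  by (metis reduced_walkE awalk_cost_nonneg)

lemma vdist_sym: 
  assumes "u \<in> verts G" "v \<in> verts G"
  shows "vdist u v = vdist v u"
proof -
  obtain p where p: "ends.awalk u p v" "reduced p" "vdist u v = ends.awalk_cost (len \<circ> fst) p"
    using reduced_walkE assms by blast
  have "ends.awalk_cost (len \<circ> fst) (reverse_walk p) = ends.awalk_cost (len \<circ> fst) p"
    by (induction p) (auto simp: reverse_walk_def)
  then show ?thesis
    using p vdist_eq_cost[OF awalk_reverse[OF p(1)]] by (simp add: reduced_reverse_walk)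
qed

lemma vdist_triangle:
  assumes "u \<in> verts G" "v \<in> verts G" "w \<in> verts G"
  shows "vdist u w \<le> vdist u v + vdist v w"
proof -
  obtain p where p: "ends.awalk u p v" "vdist u v = ends.awalk_cost (len \<circ> fst) p"
    using reduced_walkE assms by blast
  obtain q where q: "ends.awalk v q w" "vdist v w = ends.awalk_cost (len \<circ> fst) q"
    using reduced_walkE assms by blast
  obtain r where "ends.awalk u r w" "reduced r" "ends.awalk_cost (len \<circ> fst) r \<le> ends.awalk_cost (len \<circ> fst) (p @ q)"
    using reduce_walk[OF ends.awalk_appendI[OF p(1) q(1)]] by blast
  then show ?thesis using vdist_eq_cost p q by fastforce
qed

text \<open>
  A reduced walk to the tail of \<open>a\<close> either extends by \<open>a\<close> to a reduced walk, or arrives along \<open>a\<close>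
  itself and is shortened. So the distance changes by exactly the length of the edge.
\<close>
lemma vdist_step_up:
  assumes a: "a \<in> arcs ends" and p: "ends.awalk x p (tail ends a)" "reduced p"
    and last: "p = [] \<or> last p \<noteq> opposite_end a"
  shows "vdist x (head ends a) = vdist x (tail ends a) + len (fst a)"
proof -
  have "a \<noteq> opposite_end (last p)" if "p \<noteq> []" using last that by (metis opposite_end_simps(1))
  then have "reduced (p @ [a])" using p by (auto simp: reduced_append)
  moreover have "ends.awalk x (p @ [a]) (head ends a)"
    using p(1) ends.arc_implies_awalk[OF a] by (rule ends.awalk_appendI)
  ultimately show ?thesis using vdist_eq_cost[of x "p @ [a]" "head ends a"] vdist_eq_cost[OF p] by simp
qed

lemma vdist_step_down:
  assumes p: "ends.awalk x p (tail ends a)" "reduced p"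
    and last: "p \<noteq> []" "last p = opposite_end a"
  shows "vdist x (head ends a) = vdist x (tail ends a) - len (fst a)"
proof -
  obtain q where q: "p = q @ [opposite_end a]" using last by (metis append_butlast_last_id)
  have "reduced q" using p(2) q by (simp add: reduced_append)
  moreover have "ends.awalk x q (head ends a)"
    using p(1) unfolding q by (auto simp: ends.awalk_Cons_iff ends.awalk_Nil_iff)
  ultimately have "vdist x (head ends a) = ends.awalk_cost (len \<circ> fst) q"
    by (intro vdist_eq_cost)
  then show ?thesis using vdist_eq_cost[OF p] q by simp
qed

lemma vdist_step:
  assumes "a \<in> arcs ends" and p: "ends.awalk x p (tail ends a)" "reduced p"
  shows "p \<noteq> [] \<and> last p = opposite_end a \<longleftrightarrow>
           vdist x (head ends a) = vdist x (tail ends a) - len (fst a)"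
    and "\<not> (p \<noteq> [] \<and> last p = opposite_end a) \<longleftrightarrow>
           vdist x (head ends a) = vdist x (tail ends a) + len (fst a)"
proof -
  have l: "0 < len (fst a)" using assms(1) len_pos by (simp add: in_arcs_ends)
  show "p \<noteq> [] \<and> last p = opposite_end a \<longleftrightarrow>
           vdist x (head ends a) = vdist x (tail ends a) - len (fst a)"
    using vdist_step_up[OF assms] vdist_step_down[OF p] l
    by (cases "p \<noteq> [] \<and> last p = opposite_end a") auto
  show "\<not> (p \<noteq> [] \<and> last p = opposite_end a) \<longleftrightarrow>
           vdist x (head ends a) = vdist x (tail ends a) + len (fst a)"
    using vdist_step_up[OF assms] vdist_step_down[OF p] l
    by (cases "p \<noteq> [] \<and> last p = opposite_end a") auto
qed

lemma vdist_edge: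
  assumes "x \<in> verts G" "a \<in> arcs ends"
  shows "vdist x (head ends a) = vdist x (tail ends a) + len (fst a)
    \<or> vdist x (head ends a) = vdist x (tail ends a) - len (fst a)"
proof -
  obtain p where "ends.awalk x p (tail ends a)" "reduced p"
    using reduced_walkE[of x "tail ends a"] assms ends.tail_in_verts[OF assms(2)] by auto
  then show ?thesis using vdist_step(2)[OF assms(2)] vdist_step(1)[OF assms(2)] by blast
qed

text \<open>A descending end is the reversal of the last arc of the reduced walk from \<open>x\<close>.\<close>
lemma descending_end_unique:
  assumes "x \<in> verts G" "a \<in> arcs ends" "b \<in> arcs ends" "tail ends a = tail ends b"
    and "vdist x (head ends a) = vdist x (tail ends a) - len (fst a)"
    and "vdist x (head ends b) = vdist x (tail ends b) - len (fst b)"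
  shows "a = b"
proof -
  obtain p where "ends.awalk x p (tail ends a)" "reduced p"
    using reduced_walkE[of x "tail ends a"] assms ends.tail_in_verts[OF assms(2)] by auto
  then have "last p = opposite_end a" "last p = opposite_end b"
    using vdist_step(1)[of a x p] vdist_step(1)[of b x p] assms by auto
  then show ?thesis by simp
qed

text \<open>
  An edge that leads away from \<open>x\<close> and towards \<open>y\<close> lies on the path between them: the reduced walks
  from \<open>x\<close> and from \<open>y\<close> to its tail do not end with the same arc, so they join to a reduced walk.
\<close>
lemma on_geodesic:
  assumes xy: "x \<in> verts G" "y \<in> verts G" and a: "a \<in> arcs ends"
    and up: "vdist x (head ends a) = vdist x (tail ends a) + len (fst a)"
    and down: "vdist y (head ends a) = vdist y (tail ends a) - len (fst a)"
  shows "vdist x (tail ends a) + vdist y (tail ends a) = vdist x y"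
proof -
  have v: "tail ends a \<in> verts G" using ends.tail_in_verts[OF a] by simp
  obtain p where p: "ends.awalk x p (tail ends a)" "reduced p" using reduced_walkE[OF xy(1) v] by metis
  obtain q where q: "ends.awalk y q (tail ends a)" "reduced q" using reduced_walkE[OF xy(2) v] by metis
  have lp: "\<not> (p \<noteq> [] \<and> last p = opposite_end a)" using vdist_step(2)[OF a p] up by blast
  have lq: "q \<noteq> []" "last q = opposite_end a" using vdist_step(1)[OF a q] down by blast+
  have "ends.awalk x (p @ reverse_walk q) y"
    using p q awalk_reverse ends.awalk_appendI by blast
  moreover have "reduced (p @ reverse_walk q)"
    using p q lp lq
    by (auto simp: reduced_append reduced_reverse_walk)
       (auto simp: reverse_walk_def hd_rev last_map)
  moreover have "ends.awalk_cost (len \<circ> fst) (reverse_walk q) = ends.awalk_cost (len \<circ> fst) q"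
    by (induction q) (auto simp: reverse_walk_def)
  ultimately have "vdist x y = ends.awalk_cost (len \<circ> fst) p + ends.awalk_cost (len \<circ> fst) q"
    using vdist_eq_cost[of x "p @ reverse_walk q" y] by simp
  then show ?thesis using vdist_eq_cost[OF p] vdist_eq_cost[OF q] by simp
qed

lemma no_loops: "a \<in> arcs ends \<Longrightarrow> tail ends a \<noteq> head ends a"
  using no_closed_reduced_walk[of "tail ends a" "[a]"] ends.arc_implies_awalk[of a] by auto

lemma two_verts: "x \<in> verts G \<Longrightarrow> \<exists>y \<in> verts G. y \<noteq> x"
proof -
  obtain e where "e \<in> arcs G" using arcs_nonempty by blast
  then have a: "(e, True) \<in> arcs ends" by (simp add: in_arcs_ends)
  then have "tail ends (e, True) \<in> verts G" "head ends (e, True) \<in> verts G"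
    using ends.tail_in_verts[OF a] ends.head_in_verts[OF a] by simp_all
  then show ?thesis using no_loops[OF a] by metis
qed

lemma ends_at_nonempty:
  assumes "v \<in> verts G"
  shows "ends_at G v \<noteq> {}"
proof -
  obtain w where "w \<in> verts G" "w \<noteq> v" using two_verts assms by blast
  then obtain p where p: "ends.awalk v p w" using walk_exists assms by blast
  then obtain a q where "p = a # q" using \<open>w \<noteq> v\<close> by (cases p) (auto simp: ends.awalk_Nil_iff)
  then have "a \<in> ends_at G v" using p by (auto simp: in_ends_at ends.awalk_Cons_iff)
  then show ?thesis by blast
qed

lemma vdist_pos:
  assumes "u \<in> verts G" "v \<in> verts G" "u \<noteq> v"
  shows "0 < vdist u v"
proof -
  obtain p where p: "ends.awalk u p v" "vdist u v = ends.awalk_cost (len \<circ> fst) p"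
    using reduced_walkE assms by blast
  then obtain a q where aq: "p = a # q" using assms by (cases p) (auto simp: ends.awalk_Nil_iff)
  then have "a \<in> arcs ends" "ends.awalk (head ends a) q v"
    using p by (auto simp: ends.awalk_Cons_iff)
  then show ?thesis
    using p(2) aq awalk_cost_nonneg[of "head ends a" q v] len_pos[of "fst a"]
    by (simp add: in_arcs_ends)
qed

text \<open>
  At a vertex \<open>y\<close> at maximal distance from \<open>x\<close> every end descends, so there is only one.
\<close>
lemma farthest_is_leaf:
  assumes x: "x \<in> verts G"
  obtains y where "y \<in> leaves G" "y \<noteq> x" "\<And>v. v \<in> verts G \<Longrightarrow> vdist x v \<le> vdist x y"
proof -
  have fin: "finite (vdist x ` verts G)" "vdist x ` verts G \<noteq> {}" using x by auto
  obtain y where y: "y \<in> verts G" "vdist x y = Max (vdist x ` verts G)"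
    using Max_in[OF fin] by (metis imageE)
  then have max: "vdist x v \<le> vdist x y" if "v \<in> verts G" for v using fin that by simp
  have "y \<noteq> x"
    using two_verts[OF x] vdist_pos[OF x] max vdist_self[OF x] by (metis not_less)
  moreover have "a = b" if "a \<in> ends_at G y" "b \<in> ends_at G y" for a b
  proof (rule descending_end_unique[OF x])
    have "vdist x (head ends c) = vdist x (tail ends c) - len (fst c)" if "c \<in> ends_at G y" for c
    proof -
      have c: "c \<in> arcs ends" "tail ends c = y" using that by (auto simp: in_ends_at)
      have "0 < len (fst c)" using c(1) len_pos by (simp add: in_arcs_ends)
      moreover have "vdist x (head ends c) \<le> vdist x y"
        using max ends.head_in_verts[OF c(1)] by simp
      ultimately show ?thesis using vdist_edge[OF x c(1)] c(2) by auto
    qed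
    then show "vdist x (head ends a) = vdist x (tail ends a) - len (fst a)"
      "vdist x (head ends b) = vdist x (tail ends b) - len (fst b)" using that by auto
  qed (use that in \<open>auto simp: in_ends_at\<close>)
  then have "card (ends_at G y) = 1"
    using ends_at_nonempty[OF y(1)] is_singletonI'[of "ends_at G y"]
    by (simp add: is_singleton_altdef)
  ultimately show ?thesis using that max y leaves_iff by blast
qed

lemma finite_leaves: "finite (leaves G)"
  by (rule finite_subset[of _ "verts G"]) (auto simp: leaves_def)

lemma vdist_le_diam:
  assumes "x \<in> leaves G" "v \<in> verts G"
  shows "vdist x v \<le> tree_diam G len"
proof -
  have "x \<in> verts G" using assms by (simp add: leaves_def)
  then obtain y where "y \<in> leaves G" "vdist x v \<le> vdist x y" using farthest_is_leaf assms by metis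
  moreover have "vdist x y \<le> tree_diam G len"
    unfolding tree_diam_def
    by (rule Max_ge) (use finite_leaves assms \<open>y \<in> leaves G\<close> in auto)
  ultimately show ?thesis by linarith
qed

lemma diam_attained:
  obtains x y where "x \<in> leaves G" "y \<in> leaves G" "vdist x y = tree_diam G len"
proof -
  obtain v where "v \<in> verts G" using arcs_nonempty base.wellformed by blast
  then obtain y where "y \<in> leaves G" using farthest_is_leaf by metis
  then have "leaves G \<times> leaves G \<noteq> {}" by blast
  then have "tree_diam G len \<in> (\<lambda>(v, w). vdist v w) ` (leaves G \<times> leaves G)"
    unfolding tree_diam_def using finite_leaves by (intro Max_in) auto
  then show ?thesis using that by auto
qed

lemma diam_pos: "0 < tree_diam G len"
proof -
  obtain x where x: "x \<in> leaves G" using diam_attained by blast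
  then have "x \<in> verts G" by (simp add: leaves_def)
  then obtain y where "y \<in> verts G" "0 < vdist x y" using two_verts vdist_pos by metis
  then show ?thesis using vdist_le_diam[OF x] by force
qed

end

section \<open>The height over a midpoint and its cosine\<close>

lemma sum_nonneg_if_two_balance:
  fixes s :: "'c \<Rightarrow> real"
  assumes "finite A" "a \<in> A" "b \<in> A" "a \<noteq> b" "0 \<le> s a + s b"
    and "\<And>c. c \<in> A \<Longrightarrow> c \<noteq> a \<Longrightarrow> c \<noteq> b \<Longrightarrow> 0 \<le> s c"
  shows "0 \<le> sum s A"
proof -
  have "sum s A = s a + (s b + sum s (A - {a} - {b}))"
    using assms by (simp add: sum.remove[of A a] sum.remove[of "A - {a}" b])
  moreover have "0 \<le> sum s (A - {a} - {b})" by (intro sum_nonneg) (use assms in auto)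
  ultimately show ?thesis using assms by linarith
qed

context finite_metric_tree
begin

text \<open>
  The distance of \<open>v\<close> to the midpoint of the path from \<open>x\<close> to \<open>y\<close>. The midpoint may lie inside an
  edge and is never named; a path to \<open>v\<close> from one of \<open>x\<close>, \<open>y\<close> runs through it.
\<close>
definition height :: "'v \<Rightarrow> 'v \<Rightarrow> 'v \<Rightarrow> real" where
  "height x y v = max (vdist x v) (vdist y v) - vdist x y / 2"

lemma height_nonneg:
  assumes "x \<in> verts G" "y \<in> verts G" "v \<in> verts G"
  shows "0 \<le> height x y v"
  using vdist_triangle[of x v y] vdist_sym[of y v] assms by (simp add: height_def)

definition ascending :: "'v \<Rightarrow> 'e \<times> bool \<Rightarrow> bool" where
  "ascending x c \<longleftrightarrow> vdist x (head ends c) = vdist x (tail ends c) + len (fst c)"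

text \<open>
  The coordinate with origin at the midpoint that increases into the edge of the end \<open>c\<close>: the
  point at distance \<open>t\<close> from the end \<open>c\<close> has height \<open>\<bar>signed_height x y c + t\<bar>\<close>. Ends that lead to
  the midpoint have minus the height. The two mixed cases are the ends of edges on the path from
  \<open>x\<close> to \<open>y\<close>; there the sign of the coordinate may change inside the edge.
\<close>
definition signed_height :: "'v \<Rightarrow> 'v \<Rightarrow> 'e \<times> bool \<Rightarrow> real" where
  "signed_height x y c = (let v = tail ends c in
     if ascending x c then (if ascending y c then height x y v else vdist x v - vdist x y / 2)
     else (if ascending y c then vdist y v - vdist x y / 2 else - height x y v))"

lemma not_ascending:
  assumes "x \<in> verts G" "c \<in> arcs ends" "\<not> ascending x c"
  shows "vdist x (head ends c) = vdist x (tail ends c) - len (fst c)"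
  using vdist_edge[OF assms(1,2)] assms(3) by (auto simp: ascending_def)

lemma opposite_slopes:
  assumes "x \<in> verts G" "y \<in> verts G" "c \<in> arcs ends" "ascending x c" "\<not> ascending y c"
  shows "vdist x (tail ends c) + vdist y (tail ends c) = vdist x y"
  using on_geodesic[OF assms(1-3)] not_ascending[OF assms(2,3,5)] assms(4) by (simp add: ascending_def)

text \<open>
  If the distances to \<open>x\<close> and \<open>y\<close> both grow, or both shrink, along the edge, so does the height. If
  one grows and the other shrinks, the edge lies on the path from \<open>x\<close> to \<open>y\<close>, so that the two
  distances, measured from half of \<open>vdist x y\<close>, are opposite numbers.
\<close>
lemma abs_signed_height:
  assumes xy: "x \<in> verts G" "y \<in> verts G" and c: "c \<in> arcs ends"
  shows "\<bar>signed_height x y c\<bar> = height x y (tail ends c)"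
    and "\<bar>signed_height x y c + len (fst c)\<bar> = height x y (head ends c)"
proof -
  let ?v = "tail ends c" and ?w = "head ends c"
  have vw: "?v \<in> verts G" "?w \<in> verts G"
    using ends.tail_in_verts[OF c] ends.head_in_verts[OF c] by simp_all
  note nn = height_nonneg[OF xy vw(1)] height_nonneg[OF xy vw(2)]
  have l: "0 < len (fst c)" using c len_pos by (simp add: in_arcs_ends)
  note sym = vdist_sym[OF xy]
  have "\<bar>signed_height x y c\<bar> = height x y ?v \<and> \<bar>signed_height x y c + len (fst c)\<bar> = height x y ?w"
  proof (cases "ascending x c"; cases "ascending y c")
    assume a: "ascending x c" "ascending y c"
    then show ?thesis
      using nn l by (auto simp: signed_height_def height_def ascending_def Let_def max_def)
  next
    assume a: "ascending x c" "\<not> ascending y c"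
    show ?thesis
      using opposite_slopes[OF xy c a] not_ascending[OF xy(2) c a(2)] a
      by (auto simp: signed_height_def height_def ascending_def max_def abs_if)
  next
    assume a: "\<not> ascending x c" "ascending y c"
    show ?thesis
      using opposite_slopes[OF xy(2,1) c a(2,1)] not_ascending[OF xy(1) c a(1)] a sym
      by (auto simp: signed_height_def height_def ascending_def max_def abs_if)
  next
    assume a: "\<not> ascending x c" "\<not> ascending y c"
    then show ?thesis
      using nn l not_ascending[OF xy(1) c a(1)] not_ascending[OF xy(2) c a(2)]
      by (auto simp: signed_height_def height_def Let_def max_def)
  qed
  then show "\<bar>signed_height x y c\<bar> = height x y ?v" "\<bar>signed_height x y c + len (fst c)\<bar> = height x y ?w"
    by auto
qed

lemma descending_unique:
  assumes "x \<in> verts G" "a \<in> ends_at G v" "b \<in> ends_at G v" "\<not> ascending x a" "\<not> ascending x b"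
  shows "a = b"
  using descending_end_unique[of x a b] not_ascending[of x a] not_ascending[of x b] assms
  by (auto simp: in_ends_at)

text \<open>
  Up to the factor \<open>- k\<close>, this is the sum at \<open>v\<close> of the derivatives of the cosine of \<open>k\<close> times the height.
  All terms have the same absolute value. At most one end descends for \<open>x\<close> and at most one for
  \<open>y\<close>, and all other terms are nonnegative. If these are two different ends, they lie on the path
  from \<open>x\<close> to \<open>y\<close> and their terms cancel; if there is only one exceptional end, any other end
  compensates for it. If \<open>v = x = y\<close>, no end descends.
\<close>
lemma sin_signed_height_sum_nonneg:
  assumes xy: "x \<in> verts G" "y \<in> verts G" and v: "v \<in> verts G"
    and k: "0 < k" "k * height x y v < pi / 2"
    and inner: "2 \<le> card (ends_at G v) \<or> v = x \<and> v = y"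
  shows "0 \<le> (\<Sum>c\<in>ends_at G v. sin (k * signed_height x y c))"
proof -
  define h where "h = height x y v"
  define s where "s c = sin (k * signed_height x y c)" for c
  have h: "0 \<le> h" using height_nonneg[OF xy v] by (simp add: h_def)
  have "k * h \<le> pi" using k(2) pi_gt_zero unfolding h_def by linarith
  then have sin_h: "0 \<le> sin (k * h)" using h k(1) by (intro sin_ge_zero) auto
  have ends: "c \<in> arcs ends" "tail ends c = v" if "c \<in> ends_at G v" for c using that by (auto simp: in_ends_at)
  have s_lower: "- sin (k * h) \<le> s c" if c: "c \<in> ends_at G v" for c
  proof -
    have "\<bar>signed_height x y c\<bar> = h" using abs_signed_height(1)[OF xy] ends[OF c] by (simp add: h_def)
    then have "signed_height x y c = h \<or> signed_height x y c = - h" by linarith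
    then show ?thesis using sin_h by (auto simp: s_def)
  qed
  have s_up: "s c = sin (k * h)" if "c \<in> ends_at G v" "ascending x c" "ascending y c" for c
    using that ends[OF that(1)] by (simp add: s_def signed_height_def h_def)
  have "0 \<le> sum s (ends_at G v)"
  proof (cases "\<forall>c \<in> ends_at G v. ascending x c \<and> ascending y c")
    case True
    then show ?thesis using s_up sin_h by (simp add: sum_nonneg)
  next
    case False
    then obtain a where a: "a \<in> ends_at G v" "\<not> ascending x a \<or> \<not> ascending y a" by blast
    have "\<not> (v = x \<and> v = y)"
    proof
      assume vx: "v = x \<and> v = y"
      then have "ascending x a"
        using not_ascending[OF xy(1) ends(1)[OF a(1)]] ends[OF a(1)] vdist_self[OF xy(1)]
          vdist_nonneg[OF xy(1), of "head ends a"] ends.head_in_verts[OF ends(1)[OF a(1)]]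
          len_pos[of "fst a"] by (fastforce simp: in_arcs_ends)
      then show False using a(2) vx by auto
    qed
    then have card: "2 \<le> card (ends_at G v)" using inner by blast
    show ?thesis
    proof (cases "\<exists>b \<in> ends_at G v. b \<noteq> a \<and> (\<not> ascending x b \<or> \<not> ascending y b)")
      case True
      then obtain b where b: "b \<in> ends_at G v" "b \<noteq> a" "\<not> ascending x b \<or> \<not> ascending y b" by blast
      note ux = descending_unique[OF xy(1)] and uy = descending_unique[OF xy(2)]
      have opp: "ascending x a \<and> \<not> ascending y a \<and> \<not> ascending x b \<and> ascending y b
          \<or> \<not> ascending x a \<and> ascending y a \<and> ascending x b \<and> \<not> ascending y b"
        using a b ux[OF a(1) b(1)] uy[OF a(1) b(1)] by metis
      have sum0: "s a + s b = 0"
      proof -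
        have "signed_height x y a = - signed_height x y b"
          using opp opposite_slopes[OF xy ends(1)[OF a(1)]] opposite_slopes[OF xy ends(1)[OF b(1)]]
            ends[OF a(1)] ends[OF b(1)]
          by (auto simp: signed_height_def)
        then show ?thesis by (simp add: s_def)
      qed
      have "ascending x c \<and> ascending y c" if "c \<in> ends_at G v" "c \<noteq> a" "c \<noteq> b" for c
        using opp that ux[OF that(1) a(1)] ux[OF that(1) b(1)] uy[OF that(1) a(1)] uy[OF that(1) b(1)]
        by blast
      then show ?thesis
        using sum_nonneg_if_two_balance[OF finite_ends_at a(1) b(1) b(2)[symmetric], of s] sum0 s_up sin_h
        by auto
    next
      case False
      then have up: "s c = sin (k * h)" if "c \<in> ends_at G v" "c \<noteq> a" for c using s_up that by blast
      have "\<not> ends_at G v \<subseteq> {a}" using card card_mono[of "{a}" "ends_at G v"] by auto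
      then obtain b where b: "b \<in> ends_at G v" "b \<noteq> a" by blast
      show ?thesis
        by (rule sum_nonneg_if_two_balance[OF finite_ends_at a(1) b(1) b(2)[symmetric]])
           (use up b s_lower[OF a(1)] sin_h in auto)
    qed
  qed
  then show ?thesis by (simp add: s_def)
qed

text \<open>An edge is no longer than the sum of the heights of its two vertices.\<close>
lemma short_edges:
  assumes xy: "x \<in> verts G" "y \<in> verts G" and k: "0 < k"
    and bound: "\<And>v. v \<in> verts G \<Longrightarrow> k * height x y v < pi / 2" and e: "e \<in> arcs G"
  shows "k * len e < pi"
proof -
  have c: "(e, True) \<in> arcs ends" using e by (simp add: in_arcs_ends)
  have "len e \<le> height x y (tail G e) + height x y (head G e)"
    using abs_signed_height[OF xy c] by (simp add: abs_if split: if_splits)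
  then have "k * len e \<le> k * height x y (tail G e) + k * height x y (head G e)"
    using k by (metis distrib_left mult_left_mono less_imp_le)
  then show ?thesis using bound[of "tail G e"] bound[of "head G e"] e by simp
qed

lemma nonneg_energy_if_height_bounded:
  assumes xy: "x \<in> verts G" "y \<in> verts G" and k: "0 < k"
    and bound: "\<And>v. v \<in> verts G \<Longrightarrow> k * height x y v < pi / 2"
    and inner: "\<And>v. v \<in> free_verts bc \<Longrightarrow> 2 \<le> card (ends_at G v) \<or> v = x \<and> v = y"
  shows "nonneg_energy bc k"
  unfolding nonneg_energy_def
proof (intro allI impI)
  define w where "w v = cos (k * height x y v)" for v
  have short: "k * len e < pi" if "e \<in> arcs G" for e by (rule short_edges[OF xy k bound that])
  fix a :: "'v \<Rightarrow> real" assume supp: "\<forall>v. v \<notin> free_verts bc \<longrightarrow> a v = 0"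
  show "0 \<le> energy k a"
  proof (rule energy_nonneg_if_supersolution[OF k short])
    fix v assume v: "v \<in> verts G"
    have "0 \<le> k * height x y v" using height_nonneg[OF xy v] k by simp
    then show "0 < w v" using bound[OF v] unfolding w_def by (intro cos_gt_zero_pi) auto
  next
    fix v assume v: "v \<in> free_verts bc"
    then have vG: "v \<in> verts G" by (simp add: free_verts_def)
    have "flux k w c = - (k * sin (k * signed_height x y c))" if c: "c \<in> ends_at G v" for c
    proof -
      have a: "c \<in> arcs ends" and e: "fst c \<in> arcs G" using c by (auto simp: in_ends_at in_arcs_ends)
      have s: "0 < sin (k * len (fst c))" using k short[OF e] len_pos[OF e] by (intro sin_gt_zero) auto
      have abs: "cos (k * \<bar>t\<bar>) = cos (k * t)" for t by (cases "0 \<le> t") auto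
      have "w (tail ends c) = cos (k * signed_height x y c)"
        "w (head ends c) = cos (k * signed_height x y c + k * len (fst c))"
        unfolding w_def abs_signed_height[OF xy a, symmetric] abs by (simp_all add: distrib_left)
      then show ?thesis using s by (simp add: flux_def cos_add)
    qed
    then have "(\<Sum>c\<in>ends_at G v. flux k w c) = - (k * (\<Sum>c\<in>ends_at G v. sin (k * signed_height x y c)))"
      by (simp add: sum_negf sum_distrib_left)
    then show "(\<Sum>c\<in>ends_at G v. flux k w c) \<le> 0"
      using sin_signed_height_sum_nonneg[OF xy vG k bound[OF vG] inner[OF v]] k by simp
  qed (use supp in auto)
qed

text \<open>
  The common form of both bounds. The hypothesis on free vertices admits inner vertices, and the
  centre itself when \<open>x = y\<close>, where the derivative of the cosine is zero.
\<close>
lemma first_eigenvalue_ge: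
  assumes xy: "x \<in> verts G" "y \<in> verts G" and R: "0 < R"
    and bound: "\<And>v. v \<in> verts G \<Longrightarrow> height x y v \<le> R"
    and inner: "\<And>v. v \<in> free_verts bc \<Longrightarrow> 2 \<le> card (ends_at G v) \<or> v = x \<and> v = y"
    and neu: "\<And>v. v \<in> verts G \<Longrightarrow> bc v = Neumann \<Longrightarrow> card (ends_at G v) = 1"
  shows "(pi / (2 * R))\<^sup>2 \<le> first_eigenvalue G len bc"
proof -
  have bk: "k * height x y v < pi / 2" if "0 < k" "k < pi / (2 * R)" "v \<in> verts G" for k v
  proof -
    have "k * height x y v \<le> k * R" using that bound by simp
    also have "\<dots> < pi / 2" using that R by (simp add: field_simps)
    finally show ?thesis .
  qed
  have nonneg: "nonneg_energy bc k" if "0 < k" "k < pi / (2 * R)" for k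
    using nonneg_energy_if_height_bounded[OF xy that(1) bk[OF that] inner] .
  have short: "k * len e < pi" if "0 < k" "k < pi / (2 * R)" "e \<in> arcs G" for k e
    using short_edges[OF xy that(1) bk[OF that(1,2)] that(3)] .
  have half: "0 < pi / (4 * R)" "pi / (4 * R) < pi / (2 * R)" using R by (simp_all add: field_simps)
  have eig: "laplace_eigenvalue G len bc (first_eigenvalue G len bc)"
  proof (rule first_eigenvalue_is_eigenvalue[OF half(1)])
    show "tail G f \<noteq> head G f" if "f \<in> arcs G" for f
      using no_loops[of "(f, True)"] that by (simp add: in_arcs_ends)
    show "pi / (4 * R) * len e < pi" if "e \<in> arcs G" for e using short[OF half that] .
    show "nonneg_energy bc k" if "0 < k" "k \<le> pi / (4 * R)" for k
      using nonneg[OF that(1)] that(2) half(2) by linarith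
  qed (use neu ends_at_nonempty in auto)
  show ?thesis
  proof (rule square_le_if_all_smaller)
    fix k assume k: "0 < k" "k < pi / (2 * R)"
    show "k\<^sup>2 \<le> first_eigenvalue G len bc"
      using no_eigenvalue_below[OF k(1) short[OF k] neu nonneg[OF k] eig] .
  qed (use R in simp)
qed

end

theorem lemma4p6:
  fixes G :: "('v, 'e) pre_digraph" and len :: "'e \<Rightarrow> real"
  assumes "metric_tree G len"
  shows "first_eigenvalue G len (dirichlet_conditions G) \<ge> pi\<^sup>2 / (tree_diam G len)\<^sup>2
    \<and> (\<forall>n \<in> leaves G. first_eigenvalue G len ((dirichlet_conditions G)(n := Neumann))
          \<ge> pi\<^sup>2 / (4 * (tree_diam G len)\<^sup>2))"
proof (intro conjI ballI)
  interpret finite_metric_tree G len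
    using assms unfolding metric_tree_def
    by (intro finite_metric_tree.intro finite_metric_graph.intro finite_metric_tree_axioms.intro) auto
  define D where "D = tree_diam G len"
  have D: "0 < D" using diam_pos by (simp add: D_def)
  have inner: "2 \<le> card (ends_at G v)" if "v \<in> verts G" "v \<notin> leaves G" for v
  proof -
    have "card (ends_at G v) \<noteq> 0" "card (ends_at G v) \<noteq> 1"
      using ends_at_nonempty[OF that(1)] finite_ends_at that leaves_iff by auto
    then show ?thesis by linarith
  qed
  obtain x y where xy: "x \<in> leaves G" "y \<in> leaves G" "vdist x y = D"
    using diam_attained unfolding D_def by metis
  then have xyG: "x \<in> verts G" "y \<in> verts G" by (auto simp: leaves_def)
  have "(pi / (2 * (D / 2)))\<^sup>2 \<le> first_eigenvalue G len (dirichlet_conditions G)"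
  proof (rule first_eigenvalue_ge[OF xyG])
    show "height x y v \<le> D / 2" if "v \<in> verts G" for v
      using vdist_le_diam[OF xy(1) that] vdist_le_diam[OF xy(2) that] xy(3)
      by (simp add: height_def D_def)
    show "2 \<le> card (ends_at G v) \<or> v = x \<and> v = y" if "v \<in> free_verts (dirichlet_conditions G)" for v
      using that inner by (auto simp: free_verts_def dirichlet_conditions_def split: if_splits)
  qed (use D in \<open>auto simp: dirichlet_conditions_def split: if_splits\<close>)
  then show "pi\<^sup>2 / (tree_diam G len)\<^sup>2 \<le> first_eigenvalue G len (dirichlet_conditions G)"
    by (simp add: power_divide D_def)
  fix n assume n: "n \<in> leaves G"
  then have nG: "n \<in> verts G" by (simp add: leaves_def)
  let ?bc = "(dirichlet_conditions G)(n := Neumann)"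
  have "(pi / (2 * D))\<^sup>2 \<le> first_eigenvalue G len ?bc"
  proof (rule first_eigenvalue_ge[OF nG nG D])
    show "height n n v \<le> D" if "v \<in> verts G" for v
      using vdist_le_diam[OF n that] vdist_self[OF nG] by (simp add: height_def D_def)
    show "2 \<le> card (ends_at G v) \<or> v = n \<and> v = n" if "v \<in> free_verts ?bc" for v
      using that inner by (auto simp: free_verts_def dirichlet_conditions_def split: if_splits)
    show "card (ends_at G v) = 1" if "v \<in> verts G" "?bc v = Neumann" for v
      using that n leaves_iff by (auto simp: dirichlet_conditions_def split: if_splits)
  qed
  then show "pi\<^sup>2 / (4 * (tree_diam G len)\<^sup>2) \<le> first_eigenvalue G len ?bc"
    by (simp add: power_divide power_mult_distrib D_def)
qed

end
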